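(* Let $E$ be a finite directed graph without sinks or sources in which every cycle has an exit, let $u_{\mathcal J}\in\mathcal S_E$, and let $\Lambda_{\mathcal J}$ be the associated endomorphism of the Leavitt path algebra $L_{\mathbb Z}(E)$. Let $\alpha\in E^*$. Then $$\Lambda_{\mathcal J}(S_\alpha)=\sum_{\mathcal E(\omega)=\alpha}\mathcal L_s(\omega)\,\mathcal L_{\mathcal J}(\omega)\,\mathcal L_r(\omega)^*,$$ where the sum runs over all finite paths $\omega\in E_{\mathcal J}^*$ in the coding graph $E_{\mathcal J}$ with $\mathcal E(\omega)=\alpha$.
   Context: Graphs and algebras. $E=(E^0,E^1,r,s)$ is a finite directed graph (multiple edges allowed) with range and source maps $r,s$; no sinks (every vertex emits an edge), no sources (every vertex receives an edge). A path $\mu=\mu_1\cdots\mu_k$ is a sequence of edges with $r(\mu_j)=s(\mu_{j+1})$, of length $|\mu|=k$; vertices are viewed as paths of length $0$; $E^*$ is the set of finite paths, and $r,s$ extend to $E^*$. A cycle is a path of non-zero length with equal source and range; it has an exit if the source of one of its edges emits at least two distinct edges. $L_{\mathbb Z}(E)$ is the universal $\mathbb Z$-algebra generated by pairwise orthogonal idempotents $P_v$ ($v\in E^0$) and elements $S_e,S_e^*$ ($e\in E^1$) subject to $S_e^*S_f=0$ for $e\ne f$, $S_e^*S_e=P_{r(e)}$, $P_{s(e)}S_e=S_e=S_eP_{r(e)}$, $S_e^*P_{s(e)}=S_e^*=P_{r(e)}S_e^*$, and $P_v=\sum_{s(e)=v}S_eS_e^*$; it is a unital $*$-algebra with involution extending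 $S_e\mapsto S_e^*$. $S_\mu=S_{\mu_1}\cdots S_{\mu_k}$ and $S_v=P_v$ for $v\in E^0$. Unitaries and endomorphisms. For a finite set $\mathcal J\subseteq E^*\times E^*$ such that $s(\mu)=s(\nu)$ and $r(\mu)=r(\nu)$ for all $(\mu,\nu)\in\mathcal J$, put $u_{\mathcal J}=\sum_{(\mu,\nu)\in\mathcal J}S_\mu S_\nu^*$. $\mathcal S_E$ is the collection of all such $u_{\mathcal J}$ that are unitary in $L_{\mathbb Z}(E)$. For $u_{\mathcal J}\in\mathcal S_E$, $\Lambda_{\mathcal J}$ is the unital $*$-endomorphism of $L_{\mathbb Z}(E)$ with $\Lambda_{\mathcal J}(S_e)=u_{\mathcal J}S_e$ for $e\in E^1$ and $\Lambda_{\mathcal J}(P_v)=P_v$ for $v\in E^0$. Coding graph. Elements of $\mathcal J$ are written in the form $(\mu,e\nu)$, where $e\in E^1$ is the first edge of the second component and $\nu$ is the (possibly empty) remaining path; if the second component is the single edge $e$, then $\nu$ is read as the vertex $r(e)$, so $S_\nu=P_{r(e)}$. The coding graph $E_{\mathcal J}$ has vertex set $\mathcal J$, and exactly one edge $[(\mu_1,e_1\nu_1),(\mu_2,e_2\nu_2)]$ from $(\mu_1,e_1\nu_1)$ to $(\mu_2,e_2\nu_2)$ whenever $S_{\nu_1}^*S_{\mu_2}\neq0$; its label under $\mathcal L_{\mathcal J}$ is $S_{\nu_1}^*S_{\mu_2}$. $E_{\mathcal J}^*$ is the set of finite paths in $E_{\mathcal J}$ (including vertices). For a path $\omega=\omega_1\cdots\omega_{k-1}$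 in $E_{\mathcal J}$ visiting successively the vertices $(\mu_1,e_1\nu_1),\dots,(\mu_k,e_k\nu_k)$: $\mathcal L_{\mathcal J}(\omega)=\mathcal L_{\mathcal J}(\omega_1)\cdots\mathcal L_{\mathcal J}(\omega_{k-1})$ (and $\mathcal L_{\mathcal J}(\omega)=P_{r(\mu_1)}$ if $\omega$ is a single vertex), $\mathcal L_s(\omega)=S_{\mu_1}$, $\mathcal L_r(\omega)=S_{\nu_k}$, and $\mathcal E(\omega)=e_1e_2\cdots e_k\in E^*$.
   Formalization: The path α is taken of length at least 1: for a vertex α = v no path ω has 𝓔(ω) = v, so the right side is 0 while Λ(P_v) = P_v ≠ 0; second components in 𝒥 have length at least 1, as the form (μ, eν) demands. *)

theory Defs
  imports "HOL-Algebra.QuotRing" "HOL-Library.Poly_Mapping" "Graph_Theory.Arc_Walk"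
begin

section \<open>Paths in directed graphs\<close>

text \<open>
  Graphs are those of \<^theory>\<open>Graph_Theory.Digraph\<close>, with \<open>s = tail E\<close> and \<open>r = head E\<close>.
  A path is a pair of its source and its list of edges, so that vertices are
  the paths \<open>(v, [])\<close>; the source of a nonempty path is redundant but determined.
\<close>

definition graph_paths :: "('v, 'e) pre_digraph \<Rightarrow> ('v \<times> 'e list) set" where
  "graph_paths G = {(u, p). \<exists>v. pre_digraph.awalk G u p v}"

definition path_source :: "'v \<times> 'e list \<Rightarrow> 'v" where
  "path_source \<mu> = fst \<mu>"

definition path_range :: "('v, 'e) pre_digraph \<Rightarrow> 'v \<times> 'e list \<Rightarrow> 'v" where
  "path_range G \<mu> = last (pre_digraph.awalk_verts G (fst \<mu>) (snd \<mu>))"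

definition path_length :: "'v \<times> 'e list \<Rightarrow> nat" where
  "path_length \<mu> = length (snd \<mu>)"

definition no_sinks :: "('v, 'e) pre_digraph \<Rightarrow> bool" where
  "no_sinks G \<longleftrightarrow> (\<forall>v \<in> verts G. out_arcs G v \<noteq> {})"

definition no_sources :: "('v, 'e) pre_digraph \<Rightarrow> bool" where
  "no_sources G \<longleftrightarrow> (\<forall>v \<in> verts G. in_arcs G v \<noteq> {})"

text \<open>A cycle may visit a vertex repeatedly, unlike \<open>pre_digraph.cycle\<close>.\<close>

definition closed_path :: "('v, 'e) pre_digraph \<Rightarrow> 'v \<times> 'e list \<Rightarrow> bool" where
  "closed_path G \<mu> \<longleftrightarrow>
     \<mu> \<in> graph_paths G \<and> path_length \<mu> \<noteq> 0 \<and> path_source \<mu> = path_range G \<mu>"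

definition has_exit :: "('v, 'e) pre_digraph \<Rightarrow> 'v \<times> 'e list \<Rightarrow> bool" where
  "has_exit G \<mu> \<longleftrightarrow>
     (\<exists>e \<in> set (snd \<mu>). \<exists>f \<in> out_arcs G (tail G e). \<exists>g \<in> out_arcs G (tail G e). f \<noteq> g)"

section \<open>The free unital ring on the generators\<close>

datatype ('v, 'e) lpa_gen = Vertex 'v | Edge 'e | Edge_star 'e

text \<open>
  The free monoid, written additively because the product of \<open>'m \<Rightarrow>\<^sub>0 int\<close> is the
  convolution product (monoid ring) for \<open>'m :: monoid_add\<close>.
\<close>

datatype 'g monomial = Monomial (letters: "'g list")

instantiation monomial :: (type) monoid_add
begin

definition zero_monomial :: "'a monomial" where
  "zero_monomial = Monomial []"

definition plus_monomial :: "'a monomial \<Rightarrow> 'a monomial \<Rightarrow> 'a monomial" where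
  "plus_monomial m n = Monomial (letters m @ letters n)"

instance
  by standard (auto simp: zero_monomial_def plus_monomial_def)

end

type_synonym ('v, 'e) free_lpa = "('v, 'e) lpa_gen monomial \<Rightarrow>\<^sub>0 int"

definition gen :: "('v, 'e) lpa_gen \<Rightarrow> ('v, 'e) free_lpa" where
  "gen g = frag_of (Monomial [g])"

definition lpa_gens :: "('v, 'e) pre_digraph \<Rightarrow> ('v, 'e) lpa_gen set" where
  "lpa_gens E = Vertex ` verts E \<union> Edge ` arcs E \<union> Edge_star ` arcs E"

definition free_ring :: "('v, 'e) pre_digraph \<Rightarrow> ('v, 'e) free_lpa ring" where
  "free_ring E =
     \<lparr>carrier = {x. \<forall>m \<in> Poly_Mapping.keys x. set (letters m) \<subseteq> lpa_gens E},
      mult = (*), one = 1, zero = 0, add = (+)\<rparr>"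

fun gen_star :: "('v, 'e) lpa_gen \<Rightarrow> ('v, 'e) lpa_gen" where
  "gen_star (Vertex v) = Vertex v"
| "gen_star (Edge e) = Edge_star e"
| "gen_star (Edge_star e) = Edge e"

definition free_star :: "('v, 'e) free_lpa \<Rightarrow> ('v, 'e) free_lpa" where
  "free_star = frag_extend (\<lambda>m. frag_of (Monomial (rev (map gen_star (letters m)))))"

section \<open>The Leavitt path algebra over the integers\<close>

text \<open>
  Since \<open>\<Sum>\<^sub>v P\<^sub>v\<close> acts as a unit on all generators, the last relation only identifies
  the unit adjoined in \<^const>\<open>free_ring\<close> with the unit of the universal algebra.
  The defining relations themselves are those for graphs without sinks.
\<close>

inductive_set lpa_relations :: "('v, 'e) pre_digraph \<Rightarrow> ('v, 'e) free_lpa set"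
  for E :: "('v, 'e) pre_digraph"
where
  idem: "v \<in> verts E \<Longrightarrow> gen (Vertex v) * gen (Vertex v) - gen (Vertex v) \<in> lpa_relations E"
| orth: "\<lbrakk>v \<in> verts E; w \<in> verts E; v \<noteq> w\<rbrakk> \<Longrightarrow> gen (Vertex v) * gen (Vertex w) \<in> lpa_relations E"
| star_orth: "\<lbrakk>e \<in> arcs E; f \<in> arcs E; e \<noteq> f\<rbrakk> \<Longrightarrow> gen (Edge_star e) * gen (Edge f) \<in> lpa_relations E"
| star_self: "e \<in> arcs E \<Longrightarrow>
    gen (Edge_star e) * gen (Edge e) - gen (Vertex (head E e)) \<in> lpa_relations E"
| edge_source: "e \<in> arcs E \<Longrightarrow>
    gen (Vertex (tail E e)) * gen (Edge e) - gen (Edge e) \<in> lpa_relations E"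
| edge_range: "e \<in> arcs E \<Longrightarrow>
    gen (Edge e) * gen (Vertex (head E e)) - gen (Edge e) \<in> lpa_relations E"
| edge_star_source: "e \<in> arcs E \<Longrightarrow>
    gen (Edge_star e) * gen (Vertex (tail E e)) - gen (Edge_star e) \<in> lpa_relations E"
| edge_star_range: "e \<in> arcs E \<Longrightarrow>
    gen (Vertex (head E e)) * gen (Edge_star e) - gen (Edge_star e) \<in> lpa_relations E"
| vertex_sum: "v \<in> verts E \<Longrightarrow>
    gen (Vertex v) - (\<Sum>e \<in> out_arcs E v. gen (Edge e) * gen (Edge_star e)) \<in> lpa_relations E"
| unit_sum: "1 - (\<Sum>v \<in> verts E. gen (Vertex v)) \<in> lpa_relations E"

definition lpa_ideal :: "('v, 'e) pre_digraph \<Rightarrow> ('v, 'e) free_lpa set" where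
  "lpa_ideal E = Idl\<^bsub>free_ring E\<^esub> (lpa_relations E)"

definition lpa :: "('v, 'e) pre_digraph \<Rightarrow> ('v, 'e) free_lpa set ring" where
  "lpa E = free_ring E Quot lpa_ideal E"

definition lpa_P :: "('v, 'e) pre_digraph \<Rightarrow> 'v \<Rightarrow> ('v, 'e) free_lpa set" where
  "lpa_P E v = lpa_ideal E +>\<^bsub>free_ring E\<^esub> gen (Vertex v)"

definition lpa_S :: "('v, 'e) pre_digraph \<Rightarrow> 'e \<Rightarrow> ('v, 'e) free_lpa set" where
  "lpa_S E e = lpa_ideal E +>\<^bsub>free_ring E\<^esub> gen (Edge e)"

text \<open>
  Elements of the algebra are cosets, and the ideal is invariant under \<^const>\<open>free_star\<close>:
  the image of a coset is the coset of the image.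
\<close>

definition lpa_star :: "('v, 'e) free_lpa set \<Rightarrow> ('v, 'e) free_lpa set" where
  "lpa_star X = free_star ` X"

definition path_S :: "('v, 'e) pre_digraph \<Rightarrow> 'v \<times> 'e list \<Rightarrow> ('v, 'e) free_lpa set" where
  "path_S E \<mu> = (if snd \<mu> = [] then lpa_P E (fst \<mu>)
     else foldr (mult (lpa E)) (map (lpa_S E) (snd \<mu>)) \<one>\<^bsub>lpa E\<^esub>)"

section \<open>Unitaries and endomorphisms\<close>

type_synonym ('v, 'e) path_pair = "('v \<times> 'e list) \<times> ('v \<times> 'e list)"

definition parallel_pairs :: "('v, 'e) pre_digraph \<Rightarrow> ('v, 'e) path_pair set \<Rightarrow> bool" where
  "parallel_pairs E J \<longleftrightarrow> finite J \<and> J \<subseteq> graph_paths E \<times> graph_paths E \<and>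
     (\<forall>(\<mu>, \<nu>) \<in> J. path_source \<mu> = path_source \<nu> \<and> path_range E \<mu> = path_range E \<nu>)"

definition lpa_u :: "('v, 'e) pre_digraph \<Rightarrow> ('v, 'e) path_pair set \<Rightarrow> ('v, 'e) free_lpa set" where
  "lpa_u E J = (\<Oplus>\<^bsub>lpa E\<^esub>p \<in> J. path_S E (fst p) \<otimes>\<^bsub>lpa E\<^esub> lpa_star (path_S E (snd p)))"

definition lpa_unitary :: "('v, 'e) pre_digraph \<Rightarrow> ('v, 'e) free_lpa set \<Rightarrow> bool" where
  "lpa_unitary E x \<longleftrightarrow> x \<in> carrier (lpa E) \<and>
     x \<otimes>\<^bsub>lpa E\<^esub> lpa_star x = \<one>\<^bsub>lpa E\<^esub> \<and> lpa_star x \<otimes>\<^bsub>lpa E\<^esub> x = \<one>\<^bsub>lpa E\<^esub>"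

definition star_endomorphism ::
  "('v, 'e) pre_digraph \<Rightarrow> (('v, 'e) free_lpa set \<Rightarrow> ('v, 'e) free_lpa set) \<Rightarrow> bool" where
  "star_endomorphism E \<Lambda> \<longleftrightarrow> \<Lambda> \<in> ring_hom (lpa E) (lpa E) \<and>
     (\<forall>x \<in> carrier (lpa E). \<Lambda> (lpa_star x) = lpa_star (\<Lambda> x))"

text \<open>
  The generators determine a *-endomorphism on the carrier only, so its values elsewhere are
  fixed. The description is definite whenever \<open>parallel_pairs E J\<close> and \<open>lpa_u E J\<close> is unitary.
\<close>

definition lpa_Lambda ::
  "('v, 'e) pre_digraph \<Rightarrow> ('v, 'e) path_pair set \<Rightarrow> ('v, 'e) free_lpa set \<Rightarrow> ('v, 'e) free_lpa set"
where
  "lpa_Lambda E J = (THE \<Lambda>. \<Lambda> \<in> extensional (carrier (lpa E)) \<and> star_endomorphism E \<Lambda> \<and>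
     (\<forall>e \<in> arcs E. \<Lambda> (lpa_S E e) = lpa_u E J \<otimes>\<^bsub>lpa E\<^esub> lpa_S E e) \<and>
     (\<forall>v \<in> verts E. \<Lambda> (lpa_P E v) = lpa_P E v))"

section \<open>The coding graph\<close>

text \<open>
  For a vertex \<open>x = (\<mu>, e\<nu>)\<close> of the coding graph: \<open>\<mu>\<close>, \<open>e\<close> and \<open>\<nu>\<close>. If the second
  component of \<open>x\<close> is a single edge \<open>e\<close>, then \<open>code_nu E x\<close> is the vertex \<open>r(e)\<close>.
  These are meaningful only if the second component of \<open>x\<close> is not a vertex.
\<close>

definition code_mu :: "('v, 'e) path_pair \<Rightarrow> 'v \<times> 'e list" where
  "code_mu x = fst x"

definition code_edge :: "('v, 'e) path_pair \<Rightarrow> 'e" where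
  "code_edge x = hd (snd (snd x))"

definition code_nu :: "('v, 'e) pre_digraph \<Rightarrow> ('v, 'e) path_pair \<Rightarrow> 'v \<times> 'e list" where
  "code_nu E x = (head E (code_edge x), tl (snd (snd x)))"

definition code_label ::
  "('v, 'e) pre_digraph \<Rightarrow> ('v, 'e) path_pair \<times> ('v, 'e) path_pair \<Rightarrow> ('v, 'e) free_lpa set" where
  "code_label E a = lpa_star (path_S E (code_nu E (fst a))) \<otimes>\<^bsub>lpa E\<^esub> path_S E (code_mu (snd a))"

definition coding_graph ::
  "('v, 'e) pre_digraph \<Rightarrow> ('v, 'e) path_pair set \<Rightarrow>
   (('v, 'e) path_pair, ('v, 'e) path_pair \<times> ('v, 'e) path_pair) pre_digraph" where
  "coding_graph E J =
     \<lparr>verts = J, arcs = {a \<in> J \<times> J. code_label E a \<noteq> \<zero>\<^bsub>lpa E\<^esub>}, tail = fst, head = snd\<rparr>"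

type_synonym ('v, 'e) code_path =
  "('v, 'e) path_pair \<times> (('v, 'e) path_pair \<times> ('v, 'e) path_pair) list"

definition path_label :: "('v, 'e) pre_digraph \<Rightarrow> ('v, 'e) code_path \<Rightarrow> ('v, 'e) free_lpa set" where
  "path_label E \<omega> = (if snd \<omega> = [] then lpa_P E (path_range E (code_mu (fst \<omega>)))
     else foldr (mult (lpa E)) (map (code_label E) (snd \<omega>)) \<one>\<^bsub>lpa E\<^esub>)"

definition label_s :: "('v, 'e) pre_digraph \<Rightarrow> ('v, 'e) code_path \<Rightarrow> ('v, 'e) free_lpa set" where
  "label_s E \<omega> = path_S E (code_mu (path_source \<omega>))"

definition label_r ::
  "('v, 'e) pre_digraph \<Rightarrow> ('v, 'e) path_pair set \<Rightarrow> ('v, 'e) code_path \<Rightarrow> ('v, 'e) free_lpa set" where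
  "label_r E J \<omega> = path_S E (code_nu E (path_range (coding_graph E J) \<omega>))"

definition code_word ::
  "('v, 'e) pre_digraph \<Rightarrow> ('v, 'e) path_pair set \<Rightarrow> ('v, 'e) code_path \<Rightarrow> 'v \<times> 'e list" where
  "code_word E J \<omega> =
     (tail E (code_edge (path_source \<omega>)),
      map code_edge (pre_digraph.awalk_verts (coding_graph E J) (fst \<omega>) (snd \<omega>)))"

end

theory Submission
  imports Defs
begin

text \<open>
  The endomorphism lifts to the substitution \<open>S\<^sub>e \<mapsto> u S\<^sub>e\<close>, \<open>S\<^sub>e\<^sup>* \<mapsto> S\<^sub>e\<^sup>* u\<^sup>*\<close> on the free ring, which
  preserves the defining ideal because \<open>u\<close> is unitary and commutes with every \<open>P\<^sub>v\<close>. Since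
  \<open>S\<^bsub>f\<nu>\<^esub>\<^sup>* S\<^sub>e\<close> is \<open>S\<^sub>\<nu>\<^sup>*\<close> if \<open>f = e\<close> and \<open>0\<close> otherwise, \<open>u S\<^sub>e\<close> is the sum of \<open>S\<^sub>\<mu> S\<^sub>\<nu>\<^sup>*\<close> over the
  elements \<open>(\<mu>, e\<nu>)\<close> of \<open>J\<close>. Multiplying these sums along \<open>\<alpha>\<close> gives one term for each list in \<open>J\<close>
  whose edges spell \<open>\<alpha>\<close>; the terms regroup into labels, and the lists whose labels are all non-zero
  are exactly the vertex lists of paths in the coding graph.
\<close>

section \<open>The free ring\<close>

lemma gen_mult_frag_of: "gen g * frag_of (Monomial gs) = frag_of (Monomial (g # gs))"
  by (simp add: gen_def mult_single plus_monomial_def)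

text \<open>Turns claims about monomials into claims about products of generators, where induction
  on the word applies.\<close>

lemma frag_of_monomial: "frag_of (Monomial gs) = prod_list (map gen gs)"
  by (induction gs) (simp_all add: gen_mult_frag_of[symmetric] flip: zero_monomial_def)

text \<open>Both sides are additive in each argument, so a nested \<open>frag_induction\<close>
  reduces the claim to basis elements. Closure under differences suffices because the coefficients
  are integers.\<close>

lemma frag_extend_mult:
  fixes f :: "'m::monoid_add \<Rightarrow> 'n::monoid_add \<Rightarrow>\<^sub>0 int"
  assumes f: "\<And>m n. f (m + n) = f m * f n"
  shows "frag_extend f (x * y) = frag_extend f x * frag_extend f y"
proof (induction x rule: frag_induction[OF subset_UNIV])
  case (2 m)
  show ?case
    by (induction y rule: frag_induction[OF subset_UNIV])
      (simp_all add: f mult_single algebra_simps frag_extend_diff)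
qed (simp_all add: algebra_simps frag_extend_diff)

text \<open>The anti-multiplicative counterpart; it is what makes \<open>free_star\<close> reverse
  products.\<close>

lemma frag_extend_mult_rev:
  fixes f :: "'m::monoid_add \<Rightarrow> 'n::monoid_add \<Rightarrow>\<^sub>0 int"
  assumes f: "\<And>m n. f (m + n) = f n * f m"
  shows "frag_extend f (x * y) = frag_extend f y * frag_extend f x"
proof (induction x rule: frag_induction[OF subset_UNIV])
  case (2 m)
  show ?case
    by (induction y rule: frag_induction[OF subset_UNIV])
      (simp_all add: f mult_single algebra_simps frag_extend_diff)
qed (simp_all add: algebra_simps frag_extend_diff)

section \<open>The involution on the free ring\<close>

lemma free_star_add: "free_star (x + y) = free_star x + free_star y"
  by (simp add: free_star_def frag_extend_add)

lemma free_star_diff: "free_star (x - y) = free_star x - free_star y"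
  by (simp add: free_star_def frag_extend_diff)

lemma free_star_0 [simp]: "free_star 0 = 0"
  by (simp add: free_star_def)

lemma free_star_1 [simp]: "free_star 1 = 1"
  using frag_extend_of[of _ "0 :: ('a, 'b) lpa_gen monomial"]
  by (simp add: free_star_def zero_monomial_def flip: single_one)

lemma free_star_mult: "free_star (x * y) = free_star y * free_star x"
  unfolding free_star_def
  by (rule frag_extend_mult_rev) (simp add: plus_monomial_def mult_single)

lemma free_star_gen [simp]: "free_star (gen g) = gen (gen_star g)"
  by (simp add: free_star_def gen_def)

lemma free_star_sum: "free_star (sum f A) = (\<Sum>i\<in>A. free_star (f i))"
  by (induction A rule: infinite_finite_induct) (simp_all add: free_star_add)

lemma free_star_free_star [simp]: "free_star (free_star x) = x"
proof (induction x rule: frag_induction[OF subset_UNIV])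
  case (2 m)
  have "gen_star (gen_star g) = g" for g :: "('a, 'b) lpa_gen"
    by (cases g) simp_all
  then have "gen_star \<circ> gen_star = (id :: ('a, 'b) lpa_gen \<Rightarrow> _)"
    by auto
  then show ?case
    by (simp add: free_star_def rev_map)
qed (simp_all add: free_star_diff)

text \<open>The universal property of the free ring. The map acts on the whole type, so its
  algebraic laws need no carrier hypotheses.\<close>

definition free_subst ::
  "(('v, 'e) lpa_gen \<Rightarrow> ('v, 'e) free_lpa) \<Rightarrow> ('v, 'e) free_lpa \<Rightarrow> ('v, 'e) free_lpa" where
  "free_subst \<phi> = frag_extend (\<lambda>m. prod_list (map \<phi> (letters m)))"

lemma free_subst_add: "free_subst \<phi> (x + y) = free_subst \<phi> x + free_subst \<phi> y"
  by (simp add: free_subst_def frag_extend_add)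

lemma free_subst_diff: "free_subst \<phi> (x - y) = free_subst \<phi> x - free_subst \<phi> y"
  by (simp add: free_subst_def frag_extend_diff)

lemma free_subst_0 [simp]: "free_subst \<phi> 0 = 0"
  by (simp add: free_subst_def)

lemma free_subst_1 [simp]: "free_subst \<phi> 1 = 1"
  using frag_extend_of[of "\<lambda>m. prod_list (map \<phi> (letters m))" 0]
  by (simp add: free_subst_def) (simp add: zero_monomial_def)

lemma free_subst_mult: "free_subst \<phi> (x * y) = free_subst \<phi> x * free_subst \<phi> y"
  unfolding free_subst_def by (rule frag_extend_mult) (simp add: plus_monomial_def)

lemma free_subst_gen [simp]: "free_subst \<phi> (gen g) = \<phi> g"
  by (simp add: free_subst_def gen_def)

lemma free_subst_sum: "free_subst \<phi> (sum f A) = (\<Sum>i\<in>A. free_subst \<phi> (f i))"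
  by (induction A rule: infinite_finite_induct) (simp_all add: free_subst_add)

lemma free_subst_prod_list: "free_subst \<phi> (prod_list xs) = prod_list (map (free_subst \<phi>) xs)"
  by (induction xs) (simp_all add: free_subst_mult)

text \<open>Both composites are additive and reverse products, so agreement on generators is
  enough.\<close>

lemma free_subst_star:
  assumes "\<And>g. \<phi> (gen_star g) = free_star (\<phi> g)"
  shows "free_subst \<phi> (free_star x) = free_star (free_subst \<phi> x)"
proof (induction x rule: frag_induction[OF subset_UNIV])
  case (2 m)
  have "free_subst \<phi> (free_star (prod_list (map gen gs))) =
      free_star (free_subst \<phi> (prod_list (map gen gs)))" for gs
    by (induction gs) (simp_all add: free_subst_mult free_star_mult assms)
  then show ?case
    using frag_of_monomial[of "letters m"] by simp
qed (simp_all add: free_star_diff free_subst_diff)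

section \<open>Congruence modulo the defining relations\<close>

locale leavitt = fin_digraph E for E :: "('v, 'e) pre_digraph"
begin

abbreviation "F \<equiv> carrier (free_ring E)"
abbreviation "I \<equiv> lpa_ideal E"

section \<open>The carrier of the free ring\<close>

lemma free_ring_simps [simp]:
  "x \<otimes>\<^bsub>free_ring E\<^esub> y = x * y" "x \<oplus>\<^bsub>free_ring E\<^esub> y = x + y"
  "\<one>\<^bsub>free_ring E\<^esub> = 1" "\<zero>\<^bsub>free_ring E\<^esub> = 0"
  by (simp_all add: free_ring_def)

lemma F_0 [simp, intro]: "0 \<in> F" and F_1 [simp, intro]: "1 \<in> F"
  by (simp_all add: free_ring_def zero_monomial_def)

lemma F_add [intro]: "x \<in> F \<Longrightarrow> y \<in> F \<Longrightarrow> x + y \<in> F"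
  using keys_add[of x y] by (auto simp: free_ring_def)

lemma F_uminus [intro]: "x \<in> F \<Longrightarrow> - x \<in> F"
  by (simp add: free_ring_def)

lemma F_diff [intro]: "x \<in> F \<Longrightarrow> y \<in> F \<Longrightarrow> x - y \<in> F"
  using F_add[of x "- y"] F_uminus[of y] by simp

lemma F_mult [intro]: "x \<in> F \<Longrightarrow> y \<in> F \<Longrightarrow> x * y \<in> F"
  using keys_mult[of x y] by (fastforce simp: free_ring_def plus_monomial_def)

lemma F_gen: "g \<in> lpa_gens E \<Longrightarrow> gen g \<in> F"
  by (simp add: free_ring_def gen_def)

lemma F_vertex [simp, intro]: "v \<in> verts E \<Longrightarrow> gen (Vertex v) \<in> F"
  and F_edge [simp, intro]: "e \<in> arcs E \<Longrightarrow> gen (Edge e) \<in> F"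
  and F_edge_star [simp, intro]: "e \<in> arcs E \<Longrightarrow> gen (Edge_star e) \<in> F"
  by (auto intro!: F_gen simp: lpa_gens_def)

lemma F_sum [intro]: "(\<And>i. i \<in> A \<Longrightarrow> f i \<in> F) \<Longrightarrow> sum f A \<in> F"
  by (induction A rule: infinite_finite_induct) auto

lemma F_prod_list [intro]: "(\<And>x. x \<in> set xs \<Longrightarrow> x \<in> F) \<Longrightarrow> prod_list xs \<in> F"
  by (induction xs) auto

text \<open>Zero is 1 - 1, and every admissible monomial arises from 1 by multiplying with
  generators on the left; closure under differences then covers all integer combinations.\<close>

lemma F_induct [consumes 1, case_names one gen_mult diff]:
  assumes "x \<in> F" and one: "P 1"
    and gen_mult: "\<And>g y. g \<in> lpa_gens E \<Longrightarrow> y \<in> F \<Longrightarrow> P y \<Longrightarrow> P (gen g * y)"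
    and diff: "\<And>y z. y \<in> F \<Longrightarrow> z \<in> F \<Longrightarrow> P y \<Longrightarrow> P z \<Longrightarrow> P (y - z)"
  shows "P x"
proof -
  have "Poly_Mapping.keys x \<subseteq> {m. set (letters m) \<subseteq> lpa_gens E}"
    using assms(1) by (auto simp: free_ring_def)
  then have "x \<in> F \<and> P x"
  proof (induction x rule: frag_induction)
    case zero
    show ?case using diff[OF F_1 F_1 one one] by simp
  next
    case (one m)
    have "prod_list (map gen gs) \<in> F \<and> P (prod_list (map gen gs))" if "set gs \<subseteq> lpa_gens E" for gs
      using that by (induction gs) (auto intro: gen_mult F_gen \<open>P 1\<close>)
    from this[of "letters m"] show ?case
      using one frag_of_monomial[of "letters m"] by simp
  qed (auto intro: diff)
  then show ?thesis ..
qed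

lemma ring_free_ring: "ring (free_ring E)"
proof (rule ringI)
  show "abelian_group (free_ring E)"
  proof (rule abelian_groupI)
    show "\<exists>y\<in>F. y \<oplus>\<^bsub>free_ring E\<^esub> x = \<zero>\<^bsub>free_ring E\<^esub>" if "x \<in> F" for x
      using F_uminus[OF that] by (intro bexI[of _ "- x"]) simp_all
  qed (auto simp: add_ac)
  show "Group.monoid (free_ring E)"
    by (rule monoidI) (auto simp: mult.assoc)
qed (simp_all add: algebra_simps)

lemma lpa_relations_F: "lpa_relations E \<subseteq> F"
proof
  fix x assume "x \<in> lpa_relations E"
  then show "x \<in> F"
    by cases (auto intro!: F_diff F_mult F_sum)
qed

section \<open>The ideal of relations\<close>

lemma ideal_I: "ideal I (free_ring E)"
  unfolding lpa_ideal_def by (rule ring.genideal_ideal[OF ring_free_ring lpa_relations_F])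

lemma lpa_relations_I: "x \<in> lpa_relations E \<Longrightarrow> x \<in> I"
  unfolding lpa_ideal_def using ring.genideal_self[OF ring_free_ring lpa_relations_F] by blast

interpretation I: ideal I "free_ring E" by (rule ideal_I)

lemma I_F: "x \<in> I \<Longrightarrow> x \<in> F"
  by (rule I.a_Hcarr)

lemma I_0: "0 \<in> I"
  using additive_subgroup.zero_closed[OF I.is_additive_subgroup] unfolding free_ring_simps .

lemma I_add: "x \<in> I \<Longrightarrow> y \<in> I \<Longrightarrow> x + y \<in> I"
  using additive_subgroup.a_closed[OF I.is_additive_subgroup] unfolding free_ring_simps .

lemma a_inv_free_ring: "x \<in> F \<Longrightarrow> \<ominus>\<^bsub>free_ring E\<^esub> x = - x"
  by (rule abelian_group.minus_equality[OF I.is_abelian_group])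
    (use F_uminus in simp_all)

lemma I_uminus: "x \<in> I \<Longrightarrow> - x \<in> I"
  using additive_subgroup.a_inv_closed[OF I.is_additive_subgroup, of x] a_inv_free_ring[of x] I_F[of x]
  by metis

lemma I_mult: "x \<in> I \<Longrightarrow> y \<in> F \<Longrightarrow> x * y \<in> I" "x \<in> I \<Longrightarrow> y \<in> F \<Longrightarrow> y * x \<in> I"
  using I.I_l_closed[of x y] I.I_r_closed[of x y] by simp_all

text \<open>The elements of \<open>F\<close> that \<open>h\<close> sends into \<open>I\<close> form
  an ideal containing the relations, so minimality of the generated ideal applies. The disjunction
  in \<open>mult\<close> serves both the homomorphism \<open>free_lambda\<close> and the
  anti-homomorphism \<open>free_star\<close>.\<close>

lemma hom_maps_ideal:
  assumes add: "\<And>x y. h (x + y) = h x + h y"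
    and mult: "(\<forall>x y. h (x * y) = h x * h y) \<or> (\<forall>x y. h (x * y) = h y * h x)"
    and F: "\<And>x. x \<in> F \<Longrightarrow> h x \<in> F"
    and rel: "\<And>x. x \<in> lpa_relations E \<Longrightarrow> h x \<in> I"
    and "x \<in> I"
  shows "h x \<in> I"
proof -
  have zero: "h 0 = 0" using add[of 0 0] by simp
  then have uminus: "h (- x) = - h x" for x
    using add[of x "- x"] by (simp add: eq_neg_iff_add_eq_0 add.commute)
  let ?K = "{x \<in> F. h x \<in> I}"
  have "ideal ?K (free_ring E)"
  proof (rule idealI[OF ring_free_ring])
    have inv: "inv\<^bsub>add_monoid (free_ring E)\<^esub> x = - x" if "x \<in> F" for x
      using a_inv_free_ring[OF that] by (simp add: a_inv_def)
    show "subgroup ?K (add_monoid (free_ring E))"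
    proof (rule group.subgroupI[OF I.a_group])
      show "?K \<noteq> {}" using zero I_0 by auto
    next
      fix x assume x: "x \<in> ?K"
      then have "- x \<in> ?K" by (auto simp: uminus I_uminus)
      with x inv[of x] show "inv\<^bsub>add_monoid (free_ring E)\<^esub> x \<in> ?K" by auto
    next
      fix x y assume "x \<in> ?K" "y \<in> ?K"
      then have "x + y \<in> ?K" by (auto simp: add I_add)
      then show "x \<otimes>\<^bsub>add_monoid (free_ring E)\<^esub> y \<in> ?K" by simp
    qed auto
    fix x y assume xy: "x \<in> ?K" "y \<in> F"
    \<comment> \<open>Both orders are recorded, since an anti-homomorphism interchanges left and
      right multiplication.\<close>
    have "h x * h y \<in> I" "h y * h x \<in> I"
      using xy by (simp_all add: I_mult F)
    then have "y * x \<in> ?K" "x * y \<in> ?K"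
      using xy mult by auto
    then show "y \<otimes>\<^bsub>free_ring E\<^esub> x \<in> ?K" "x \<otimes>\<^bsub>free_ring E\<^esub> y \<in> ?K"
      by simp_all
  qed
  moreover have "lpa_relations E \<subseteq> ?K"
    using lpa_relations_F rel by auto
  ultimately have "I \<subseteq> ?K"
    unfolding lpa_ideal_def by (rule ring.genideal_minimal[OF ring_free_ring])
  with \<open>x \<in> I\<close> show ?thesis by auto
qed

text \<open>Equality in the Leavitt path algebra, expressed on representatives; see
  \<open>lpa_class_eq_iff\<close>. Membership in \<open>F\<close> is built in because the type also
  contains polynomials in letters that do not come from the graph.\<close>

definition lpa_cong :: "('v, 'e) free_lpa \<Rightarrow> ('v, 'e) free_lpa \<Rightarrow> bool" (infix "\<approx>" 50) where
  "x \<approx> y \<longleftrightarrow> x \<in> F \<and> y \<in> F \<and> x - y \<in> I"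

lemma cong_F: "x \<approx> y \<Longrightarrow> x \<in> F" "x \<approx> y \<Longrightarrow> y \<in> F"
  by (simp_all add: lpa_cong_def)

lemma cong_refl [simp, intro]: "x \<in> F \<Longrightarrow> x \<approx> x"
  by (simp add: lpa_cong_def I_0)

lemma cong_sym: "x \<approx> y \<Longrightarrow> y \<approx> x"
  using I_uminus[of "x - y"] by (simp add: lpa_cong_def)

lemma cong_trans [trans]: "x \<approx> y \<Longrightarrow> y \<approx> z \<Longrightarrow> x \<approx> z"
  using I_add[of "x - y" "y - z"] by (simp add: lpa_cong_def)

lemma cong_add: "x \<approx> y \<Longrightarrow> x' \<approx> y' \<Longrightarrow> x + x' \<approx> y + y'"
  using I_add[of "x - y" "x' - y'"] by (auto simp: lpa_cong_def algebra_simps)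

lemma cong_mult:
  assumes "x \<approx> y" "x' \<approx> y'" shows "x * x' \<approx> y * y'"
proof -
  have "(x - y) * x' + y * (x' - y') \<in> I"
    using assms by (intro I_add I_mult) (auto simp: lpa_cong_def)
  then show ?thesis
    using assms by (auto simp: lpa_cong_def algebra_simps)
qed

lemma cong_sum: "(\<And>i. i \<in> A \<Longrightarrow> f i \<approx> g i) \<Longrightarrow> sum f A \<approx> sum g A"
  by (induction A rule: infinite_finite_induct) (auto intro: cong_add)

lemma cong_prod_list: "(\<And>x. x \<in> set xs \<Longrightarrow> f x \<approx> g x) \<Longrightarrow>
    prod_list (map f xs) \<approx> prod_list (map g xs)"
  by (induction xs) (auto intro: cong_mult)

lemma cong_rel: "x - y \<in> lpa_relations E \<Longrightarrow> x \<in> F \<Longrightarrow> y \<in> F \<Longrightarrow> x \<approx> y"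
  by (simp add: lpa_cong_def lpa_relations_I)

lemma cong_diff_I: "x \<approx> y \<Longrightarrow> x - y \<in> I"
  by (simp add: lpa_cong_def)

lemma cong_0_I: "x \<approx> 0 \<Longrightarrow> x \<in> I"
  by (simp add: lpa_cong_def)

section \<open>The defining relations as congruences\<close>

lemma cong_vertex_vertex:
  "v \<in> verts E \<Longrightarrow> w \<in> verts E \<Longrightarrow>
    gen (Vertex v) * gen (Vertex w) \<approx> (if v = w then gen (Vertex v) else 0)"
  by (auto intro!: cong_rel F_mult intro: lpa_relations.idem lpa_relations.orth)

lemma cong_star_edge:
  "e \<in> arcs E \<Longrightarrow> f \<in> arcs E \<Longrightarrow>
    gen (Edge_star e) * gen (Edge f) \<approx> (if e = f then gen (Vertex (head E e)) else 0)"
  by (auto intro!: cong_rel F_mult intro: lpa_relations.star_self lpa_relations.star_orth)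

lemma cong_tail_edge: "e \<in> arcs E \<Longrightarrow> gen (Vertex (tail E e)) * gen (Edge e) \<approx> gen (Edge e)"
  by (auto intro!: cong_rel F_mult intro: lpa_relations.edge_source)

lemma cong_edge_head: "e \<in> arcs E \<Longrightarrow> gen (Edge e) * gen (Vertex (head E e)) \<approx> gen (Edge e)"
  by (auto intro!: cong_rel F_mult intro: lpa_relations.edge_range)

lemma cong_vertex_sum:
  "v \<in> verts E \<Longrightarrow> gen (Vertex v) \<approx> (\<Sum>e\<in>out_arcs E v. gen (Edge e) * gen (Edge_star e))"
  by (auto intro!: cong_rel F_mult F_sum intro: lpa_relations.vertex_sum)

lemma cong_unit_sum: "1 \<approx> (\<Sum>v\<in>verts E. gen (Vertex v))"
  by (auto intro!: cong_rel F_sum intro: lpa_relations.unit_sum)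

text \<open>Inserting the source idempotent of the edge reduces the product to orthogonality of the
  vertex idempotents.\<close>

lemma cong_vertex_edge:
  assumes "v \<in> verts E" "e \<in> arcs E"
  shows "gen (Vertex v) * gen (Edge e) \<approx> (if v = tail E e then gen (Edge e) else 0)"
proof -
  have "gen (Vertex v) * gen (Edge e) \<approx> gen (Vertex v) * (gen (Vertex (tail E e)) * gen (Edge e))"
    using assms by (intro cong_mult cong_sym[OF cong_tail_edge]) auto
  also have "\<dots> = (gen (Vertex v) * gen (Vertex (tail E e))) * gen (Edge e)"
    by (simp add: mult.assoc)
  also have "\<dots> \<approx> (if v = tail E e then gen (Vertex v) else 0) * gen (Edge e)"
    using assms by (intro cong_mult cong_vertex_vertex) auto
  also have "\<dots> \<approx> (if v = tail E e then gen (Edge e) else 0)"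
    using cong_tail_edge assms by auto
  finally show ?thesis .
qed

section \<open>Compatibility with the involution\<close>

lemma F_free_star [intro]: "x \<in> F \<Longrightarrow> free_star x \<in> F"
proof (induction rule: F_induct)
  case (gen_mult g y)
  then have "gen_star g \<in> lpa_gens E"
    by (auto simp: lpa_gens_def)
  with gen_mult show ?case by (auto simp: free_star_mult intro: F_gen)
qed (auto simp: free_star_diff)

text \<open>The set of relations is itself closed under the star: it exchanges the source relations
  of an edge and its adjoint, likewise the range relations, and swaps the two indices in the
  orthogonality relations.\<close>

lemma free_star_I: "x \<in> I \<Longrightarrow> free_star x \<in> I"
proof (rule hom_maps_ideal[where h = free_star])
  fix x assume "x \<in> lpa_relations E"
  then have "free_star x \<in> lpa_relations E"
    by cases (auto simp: free_star_diff free_star_mult free_star_sum intro: lpa_relations.intros)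
  then show "free_star x \<in> I" by (rule lpa_relations_I)
qed (auto simp: free_star_add free_star_mult)

lemma cong_star: "x \<approx> y \<Longrightarrow> free_star x \<approx> free_star y"
  using free_star_I[of "x - y"] by (auto simp: lpa_cong_def free_star_diff)

section \<open>The Leavitt path algebra as a quotient\<close>

definition lpa_class :: "('v, 'e) free_lpa \<Rightarrow> ('v, 'e) free_lpa set" where
  "lpa_class x = I +>\<^bsub>free_ring E\<^esub> x"

lemma lpa_class_conv: "lpa_class x = (\<lambda>i. i + x) ` I"
  unfolding lpa_class_def a_r_coset_def' by auto

lemma ring_lpa: "ring (lpa E)"
  unfolding lpa_def by (rule I.quotient_is_ring)

lemma carrier_lpa: "carrier (lpa E) = lpa_class ` F"
  by (auto simp: lpa_def FactRing_def A_RCOSETS_def' lpa_class_def)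

lemma lpa_class_closed [simp, intro]: "x \<in> F \<Longrightarrow> lpa_class x \<in> carrier (lpa E)"
  by (simp add: carrier_lpa)

lemma lpa_class_mult: "x \<in> F \<Longrightarrow> y \<in> F \<Longrightarrow> lpa_class x \<otimes>\<^bsub>lpa E\<^esub> lpa_class y = lpa_class (x * y)"
  using ring_hom_mult[OF I.rcos_ring_hom, of x y]
  by (simp add: lpa_def lpa_class_def)

lemma lpa_class_add: "x \<in> F \<Longrightarrow> y \<in> F \<Longrightarrow> lpa_class x \<oplus>\<^bsub>lpa E\<^esub> lpa_class y = lpa_class (x + y)"
  using ring_hom_add[OF I.rcos_ring_hom, of x y]
  by (simp add: lpa_def lpa_class_def)

lemma lpa_class_one: "\<one>\<^bsub>lpa E\<^esub> = lpa_class 1"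
  by (simp add: lpa_def lpa_class_def FactRing_def)

lemma lpa_class_zero: "\<zero>\<^bsub>lpa E\<^esub> = lpa_class 0"
  by (simp add: lpa_def lpa_class_conv FactRing_def)

lemma lpa_class_eq_iff:
  assumes "x \<in> F" "y \<in> F" shows "lpa_class x = lpa_class y \<longleftrightarrow> x \<approx> y"
proof
  assume "lpa_class x = lpa_class y"
  then have "0 + x \<in> (\<lambda>i. i + y) ` I"
    using I_0 by (auto simp: lpa_class_conv)
  then show "x \<approx> y" using assms by (auto simp: lpa_cong_def)
next
  assume "x \<approx> y"
  then have "x \<in> lpa_class y"
    by (auto simp: lpa_class_conv lpa_cong_def intro!: image_eqI[of _ _ "x - y"])
  then show "lpa_class x = lpa_class y"
    using I.a_repr_independence'[of x y] assms by (simp add: lpa_class_def)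
qed

lemma lpa_class_cong: "x \<approx> y \<Longrightarrow> lpa_class x = lpa_class y"
  using lpa_class_eq_iff cong_F by blast

lemma lpa_class_finsum:
  assumes "\<And>i. i \<in> A \<Longrightarrow> f i \<in> F"
  shows "(\<Oplus>\<^bsub>lpa E\<^esub>i\<in>A. lpa_class (f i)) = lpa_class (sum f A)"
proof -
  interpret L: ring "lpa E" by (rule ring_lpa)
  show ?thesis
    using assms
  proof (induction A rule: infinite_finite_induct)
    case (insert i A)
    then have "(\<Oplus>\<^bsub>lpa E\<^esub>i\<in>insert i A. lpa_class (f i)) =
        lpa_class (f i) \<oplus>\<^bsub>lpa E\<^esub> (\<Oplus>\<^bsub>lpa E\<^esub>i\<in>A. lpa_class (f i))"
      by (intro L.finsum_insert) auto
    then show ?case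
      using insert by (simp add: lpa_class_add F_sum)
  qed (simp_all add: lpa_class_zero)
qed

lemma lpa_class_foldr:
  assumes "set xs \<subseteq> F"
  shows "foldr (mult (lpa E)) (map lpa_class xs) \<one>\<^bsub>lpa E\<^esub> = lpa_class (prod_list xs)"
  using assms by (induction xs) (auto simp: lpa_class_one lpa_class_mult F_prod_list subset_iff)

text \<open>The star is an involution preserving \<open>I\<close>, hence maps \<open>I\<close> onto
  itself; so the image of a coset is again a full coset.\<close>

lemma lpa_star_class: "lpa_star (lpa_class x) = lpa_class (free_star x)"
proof -
  have "free_star ` I = I"
  proof
    show "I \<subseteq> free_star ` I"
      using free_star_I by (metis free_star_free_star image_iff subsetI)
  qed (auto intro: free_star_I)
  then have "(\<lambda>i. i + free_star x) ` free_star ` I = (\<lambda>i. i + free_star x) ` I"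
    by simp
  then show ?thesis
    by (simp add: lpa_star_def lpa_class_conv image_image free_star_add)
qed

lemma lpa_P_class: "lpa_P E v = lpa_class (gen (Vertex v))"
  and lpa_S_class: "lpa_S E e = lpa_class (gen (Edge e))"
  by (simp_all add: lpa_P_def lpa_S_def lpa_class_def)

end

section \<open>Path monomials\<close>

text \<open>Representative of \<open>path_S\<close> in the free ring. The vertex case is separate
  because the empty product is 1 and not a vertex idempotent.\<close>

definition free_path :: "'v \<times> 'e list \<Rightarrow> ('v, 'e) free_lpa" where
  "free_path \<mu> =
     (if snd \<mu> = [] then gen (Vertex (fst \<mu>)) else prod_list (map (\<lambda>e. gen (Edge e)) (snd \<mu>)))"

definition free_u :: "('v, 'e) path_pair set \<Rightarrow> ('v, 'e) free_lpa" where
  "free_u J = (\<Sum>x\<in>J. free_path (fst x) * free_star (free_path (snd x)))"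

context leavitt
begin

lemma graph_pathsD:
  assumes "\<mu> \<in> graph_paths E"
  shows "fst \<mu> \<in> verts E" "set (snd \<mu>) \<subseteq> arcs E" "cas (fst \<mu>) (snd \<mu>) (path_range E \<mu>)"
  using assms by (auto simp: graph_paths_def awalk_def path_range_def awlast_if_cas)

lemma F_edges [intro]: "set p \<subseteq> arcs E \<Longrightarrow> prod_list (map (\<lambda>e. gen (Edge e)) p) \<in> F"
  by (induction p) auto

lemma F_free_path [intro]: "\<mu> \<in> graph_paths E \<Longrightarrow> free_path \<mu> \<in> F"
  using graph_pathsD[of \<mu>] by (auto simp: free_path_def)

lemma path_S_class: "\<mu> \<in> graph_paths E \<Longrightarrow> path_S E \<mu> = lpa_class (free_path \<mu>)"
  using graph_pathsD(2)[of \<mu>] lpa_class_foldr[of "map (\<lambda>e. gen (Edge e)) (snd \<mu>)"]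
  by (simp add: path_S_def free_path_def lpa_P_class lpa_S_class[abs_def] comp_def image_subset_iff
      subset_eq)

text \<open>Only the first letter of the path meets the vertex, so orthogonality of vertices or
  \<open>cong_vertex_edge\<close> decides the product.\<close>

lemma cong_vertex_path:
  assumes v: "v \<in> verts E" and \<mu>: "\<mu> \<in> graph_paths E"
  shows "gen (Vertex v) * free_path \<mu> \<approx> (if v = fst \<mu> then free_path \<mu> else 0)"
proof (cases "snd \<mu>")
  case Nil
  then show ?thesis
    using cong_vertex_vertex[OF v graph_pathsD(1)[OF \<mu>]] by (auto simp: free_path_def)
next
  case (Cons e p)
  let ?r = "prod_list (map (\<lambda>e. gen (Edge e)) p)"
  have e: "e \<in> arcs E" "set p \<subseteq> arcs E" "tail E e = fst \<mu>"
    using graph_pathsD[OF \<mu>] Cons by auto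
  have "(gen (Vertex v) * gen (Edge e)) * ?r \<approx> (if v = fst \<mu> then gen (Edge e) else 0) * ?r"
    using cong_vertex_edge[OF v e(1)] e by (intro cong_mult) auto
  then show ?thesis
    using Cons by (cases "v = fst \<mu>") (simp_all add: free_path_def mult.assoc)
qed

lemma cong_path_vertex:
  assumes \<mu>: "\<mu> \<in> graph_paths E"
  shows "free_path \<mu> * gen (Vertex (path_range E \<mu>)) \<approx> free_path \<mu>"
proof (cases "snd \<mu>" rule: rev_cases)
  case Nil
  then show ?thesis
    using cong_vertex_vertex[of "fst \<mu>" "fst \<mu>"] graph_pathsD[OF \<mu>]
    by (simp add: free_path_def)
next
  case (snoc p e)
  let ?r = "prod_list (map (\<lambda>e. gen (Edge e)) p)"
  have e: "e \<in> arcs E" "set p \<subseteq> arcs E" "path_range E \<mu> = head E e"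
    using graph_pathsD[OF \<mu>] snoc by (auto simp: path_range_def awalk_verts_conv)
  have "?r * (gen (Edge e) * gen (Vertex (head E e))) \<approx> ?r * gen (Edge e)"
    using cong_edge_head[OF e(1)] e by (intro cong_mult) auto
  then show ?thesis
    using snoc e by (simp add: free_path_def mult.assoc)
qed

section \<open>The element u of a set of parallel pairs\<close>

lemma parallel_pairsD:
  assumes "parallel_pairs E J" "x \<in> J"
  shows "fst x \<in> graph_paths E" "snd x \<in> graph_paths E"
    "fst (fst x) = fst (snd x)" "path_range E (fst x) = path_range E (snd x)"
  using assms by (force simp: parallel_pairs_def path_source_def)+

lemma F_free_u [intro]: "parallel_pairs E J \<Longrightarrow> free_u J \<in> F"
  unfolding free_u_def by (intro F_sum F_mult F_free_star F_free_path parallel_pairsD)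

lemma lpa_u_class:
  assumes "parallel_pairs E J"
  shows "lpa_u E J = lpa_class (free_u J)"
proof -
  interpret L: ring "lpa E" by (rule ring_lpa)
  note J = parallel_pairsD[OF assms]
  have "lpa_u E J = (\<Oplus>\<^bsub>lpa E\<^esub>x\<in>J. lpa_class (free_path (fst x) * free_star (free_path (snd x))))"
    unfolding lpa_u_def using J
    by (intro L.finsum_cong')
      (auto simp: path_S_class lpa_star_class lpa_class_mult F_free_path F_free_star
        intro!: lpa_class_closed F_mult)
  also have "\<dots> = lpa_class (free_u J)"
    unfolding free_u_def using J by (intro lpa_class_finsum F_mult F_free_star F_free_path)
  finally show ?thesis .
qed

lemma lpa_unitary_class:
  assumes "u \<in> F" "lpa_unitary E (lpa_class u)"
  shows "u * free_star u \<approx> 1" "free_star u * u \<approx> 1"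
  using assms
  by (auto simp: lpa_unitary_def lpa_star_class lpa_class_mult lpa_class_one F_free_star F_mult
      lpa_class_eq_iff)

text \<open>Each summand commutes with the vertex idempotent: its two paths have the same source, so
  both products are the summand itself if v is that source and vanish otherwise.\<close>

lemma cong_vertex_free_u:
  assumes J: "parallel_pairs E J" and v: "v \<in> verts E"
  shows "gen (Vertex v) * free_u J \<approx> free_u J * gen (Vertex v)"
proof -
  have "gen (Vertex v) * (free_path (fst x) * free_star (free_path (snd x))) \<approx>
      free_path (fst x) * free_star (free_path (snd x)) * gen (Vertex v)" if "x \<in> J" for x
  proof -
    note x = parallel_pairsD[OF J that]
    let ?a = "free_path (fst x)" and ?b = "free_path (snd x)"
    have [intro]: "?a \<in> F" "?b \<in> F" using x by auto
    have "gen (Vertex v) * (?a * free_star ?b) = gen (Vertex v) * ?a * free_star ?b"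
      by (simp add: mult.assoc)
    also have "\<dots> \<approx> (if v = fst (fst x) then ?a else 0) * free_star ?b"
      using x v by (intro cong_mult cong_vertex_path) auto
    \<comment> \<open>The common source lets the case distinction move from the left factor to the
      right one.\<close>
    also have "\<dots> = ?a * free_star (if v = fst (snd x) then ?b else 0)"
      using x by simp
    also have "\<dots> \<approx> ?a * free_star (gen (Vertex v) * ?b)"
      using x v by (intro cong_mult cong_star cong_sym[OF cong_vertex_path]) auto
    also have "\<dots> = ?a * free_star ?b * gen (Vertex v)"
      by (simp add: free_star_mult mult.assoc)
    finally show ?thesis .
  qed
  then show ?thesis
    unfolding free_u_def sum_distrib_left sum_distrib_right by (rule cong_sum)
qed

end

section \<open>The endomorphism of a unitary\<close>

text \<open>The value at \<open>Edge_star e\<close> is forced by compatibility with the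
  star.\<close>

fun lambda_gen :: "('v, 'e) free_lpa \<Rightarrow> ('v, 'e) lpa_gen \<Rightarrow> ('v, 'e) free_lpa" where
  "lambda_gen u (Vertex v) = gen (Vertex v)"
| "lambda_gen u (Edge e) = u * gen (Edge e)"
| "lambda_gen u (Edge_star e) = gen (Edge_star e) * free_star u"

abbreviation free_lambda :: "('v, 'e) free_lpa \<Rightarrow> ('v, 'e) free_lpa \<Rightarrow> ('v, 'e) free_lpa" where
  "free_lambda u \<equiv> free_subst (lambda_gen u)"

lemma free_lambda_star: "free_lambda u (free_star x) = free_star (free_lambda u x)"
proof (rule free_subst_star)
  fix g show "lambda_gen u (gen_star g) = free_star (lambda_gen u g)"
    by (cases g) (simp_all add: free_star_mult)
qed

text \<open>Isolates what the endomorphism takes from u: unitarity and commutation with the vertex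
  idempotents, both only modulo \<open>I\<close>.\<close>

locale leavitt_unitary = leavitt E for E :: "('v, 'e) pre_digraph" +
  fixes u :: "('v, 'e) free_lpa"
  assumes u_F [simp, intro]: "u \<in> F"
    and u_star: "u * free_star u \<approx> 1" and star_u: "free_star u * u \<approx> 1"
    and vertex_u: "v \<in> verts E \<Longrightarrow> gen (Vertex v) * u \<approx> u * gen (Vertex v)"
begin

lemma F_lambda_gen: "g \<in> lpa_gens E \<Longrightarrow> lambda_gen u g \<in> F"
  by (cases g) (auto simp: lpa_gens_def intro!: F_mult F_free_star)

lemma F_free_lambda [intro]: "x \<in> F \<Longrightarrow> free_lambda u x \<in> F"
  by (induction rule: F_induct) (auto simp: free_subst_diff free_subst_mult F_lambda_gen)

text \<open>The middle factor \<open>free_star u * u\<close> cancels, so the relations between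
  adjoint edges and edges survive the substitution.\<close>

lemma cong_lambda_star_edge:
  assumes "e \<in> arcs E" "f \<in> arcs E"
  shows "gen (Edge_star e) * free_star u * (u * gen (Edge f)) \<approx> gen (Edge_star e) * gen (Edge f)"
proof -
  have "gen (Edge_star e) * (free_star u * u) * gen (Edge f) \<approx>
      gen (Edge_star e) * 1 * gen (Edge f)"
    using assms by (intro cong_mult star_u) auto
  then show ?thesis by (simp add: mult.assoc)
qed

text \<open>Commutation moves the source vertex past u to the edge, which absorbs it.\<close>

lemma cong_lambda_tail_edge:
  assumes e: "e \<in> arcs E"
  shows "gen (Vertex (tail E e)) * (u * gen (Edge e)) \<approx> u * gen (Edge e)"
proof -
  have "gen (Vertex (tail E e)) * u * gen (Edge e) \<approx> u * gen (Vertex (tail E e)) * gen (Edge e)"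
    using e by (intro cong_mult vertex_u) auto
  also have "\<dots> = u * (gen (Vertex (tail E e)) * gen (Edge e))"
    by (simp add: mult.assoc)
  also have "\<dots> \<approx> u * gen (Edge e)"
    using e by (intro cong_mult cong_tail_edge) auto
  finally show ?thesis by (simp add: mult.assoc)
qed

lemma cong_lambda_edge_head:
  assumes e: "e \<in> arcs E"
  shows "u * gen (Edge e) * gen (Vertex (head E e)) \<approx> u * gen (Edge e)"
  using cong_mult[OF cong_refl[OF u_F] cong_edge_head[OF e]] by (simp add: mult.assoc)

text \<open>Unitarity and commutation give that P_v equals P_v conjugated by u; expanding the inner
  P_v yields the sum.\<close>

lemma cong_lambda_vertex_sum:
  assumes v: "v \<in> verts E"
  shows "gen (Vertex v) \<approx>
    (\<Sum>e\<in>out_arcs E v. u * gen (Edge e) * (gen (Edge_star e) * free_star u))"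
proof -
  have "gen (Vertex v) * 1 \<approx> gen (Vertex v) * (u * free_star u)"
    using v by (intro cong_mult cong_sym[OF u_star]) auto
  also have "\<dots> = gen (Vertex v) * u * free_star u"
    by (simp add: mult.assoc)
  also have "\<dots> \<approx> u * gen (Vertex v) * free_star u"
    using v by (intro cong_mult vertex_u) auto
  also have "\<dots> \<approx> u * (\<Sum>e\<in>out_arcs E v. gen (Edge e) * gen (Edge_star e)) * free_star u"
    using v by (intro cong_mult cong_vertex_sum) auto
  also have "\<dots> = (\<Sum>e\<in>out_arcs E v. u * gen (Edge e) * (gen (Edge_star e) * free_star u))"
    by (simp add: sum_distrib_left sum_distrib_right mult.assoc)
  finally show ?thesis by simp
qed

text \<open>Relations among vertices alone are fixed, and the two relations for an adjoint edge are
  the stars of those for the edge; the rest are the preceding congruences.\<close>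

lemma free_lambda_relation:
  assumes "x \<in> lpa_relations E"
  shows "free_lambda u x \<in> I"
  using assms
proof cases
  case (idem v)
  then show ?thesis
    by (auto simp: free_subst_diff free_subst_mult intro: lpa_relations_I lpa_relations.idem)
next
  case (orth v w)
  then show ?thesis
    by (auto simp: free_subst_mult intro: lpa_relations_I lpa_relations.orth)
next
  case (star_orth e f)
  have "gen (Edge_star e) * free_star u * (u * gen (Edge f)) \<approx> 0"
    using cong_trans[OF cong_lambda_star_edge cong_star_edge, of e f] star_orth by simp
  then show ?thesis
    using star_orth by (simp add: free_subst_mult cong_0_I)
next
  case (star_self e)
  have "gen (Edge_star e) * free_star u * (u * gen (Edge e)) \<approx> gen (Vertex (head E e))"
    using cong_trans[OF cong_lambda_star_edge cong_star_edge, of e e] star_self by simp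
  then show ?thesis
    using star_self by (simp add: free_subst_diff free_subst_mult cong_diff_I)
next
  case (edge_source e)
  then show ?thesis
    using cong_lambda_tail_edge by (simp add: free_subst_diff free_subst_mult cong_diff_I)
next
  case (edge_range e)
  then show ?thesis
    using cong_lambda_edge_head by (simp add: free_subst_diff free_subst_mult cong_diff_I)
next
  case (edge_star_source e)
  then show ?thesis
    using cong_star[OF cong_lambda_tail_edge[of e]]
    by (simp add: free_subst_diff free_subst_mult free_star_mult cong_diff_I)
next
  case (edge_star_range e)
  then show ?thesis
    using cong_star[OF cong_lambda_edge_head[of e]]
    by (simp add: free_subst_diff free_subst_mult free_star_mult cong_diff_I)
next
  case (vertex_sum v)
  then show ?thesis
    using cong_lambda_vertex_sum
    by (simp add: free_subst_diff free_subst_mult free_subst_sum cong_diff_I)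
next
  case unit_sum
  then show ?thesis
    using cong_diff_I[OF cong_unit_sum] by (simp add: free_subst_diff free_subst_sum)
qed

lemma free_lambda_I: "x \<in> I \<Longrightarrow> free_lambda u x \<in> I"
  by (rule hom_maps_ideal) (auto simp: free_subst_add free_subst_mult intro: free_lambda_relation)

lemma cong_free_lambda: "x \<approx> y \<Longrightarrow> free_lambda u x \<approx> free_lambda u y"
  using free_lambda_I[of "x - y"] by (auto simp: lpa_cong_def free_subst_diff)

text \<open>A representative is picked by choice; \<open>lambda_class\<close> shows that the choice
  is immaterial. The restriction meets the extensionality demanded by
  \<open>lpa_Lambda\<close>.\<close>

definition lambda :: "('v, 'e) free_lpa set \<Rightarrow> ('v, 'e) free_lpa set" where
  "lambda = restrict (\<lambda>X. lpa_class (free_lambda u (SOME x. x \<in> F \<and> lpa_class x = X)))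
     (carrier (lpa E))"

lemma lambda_class:
  assumes x: "x \<in> F"
  shows "lambda (lpa_class x) = lpa_class (free_lambda u x)"
proof -
  let ?y = "SOME y. y \<in> F \<and> lpa_class y = lpa_class x"
  have "?y \<in> F \<and> lpa_class ?y = lpa_class x"
    using someI[of "\<lambda>y. y \<in> F \<and> lpa_class y = lpa_class x" x] x by simp
  then have "?y \<approx> x" using lpa_class_eq_iff x by blast
  then show ?thesis
    using x by (simp add: lambda_def lpa_class_cong cong_free_lambda)
qed

lemma star_endomorphism_lambda: "star_endomorphism E lambda"
  unfolding star_endomorphism_def
proof
  show "lambda \<in> ring_hom (lpa E) (lpa E)"
    by (rule ring_hom_memI)
      (auto simp: carrier_lpa lambda_class lpa_class_mult lpa_class_add lpa_class_one
        free_subst_add free_subst_mult F_add F_mult F_free_lambda)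
  show "\<forall>x\<in>carrier (lpa E). lambda (lpa_star x) = lpa_star (lambda x)"
    by (auto simp: carrier_lpa lambda_class lpa_star_class F_free_star free_lambda_star)
qed

text \<open>Uniqueness: the hypotheses fix the values on all generators, those of adjoint edges
  through the star, and a ring homomorphism is determined by them.\<close>

lemma star_endomorphism_eq_lambda:
  assumes \<Lambda>: "star_endomorphism E \<Lambda>"
    and S: "\<And>e. e \<in> arcs E \<Longrightarrow> \<Lambda> (lpa_S E e) = lpa_class u \<otimes>\<^bsub>lpa E\<^esub> lpa_S E e"
    and P: "\<And>v. v \<in> verts E \<Longrightarrow> \<Lambda> (lpa_P E v) = lpa_P E v"
    and "x \<in> F"
  shows "\<Lambda> (lpa_class x) = lpa_class (free_lambda u x)"
proof -
  have hom: "\<Lambda> \<in> ring_hom (lpa E) (lpa E)"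
    and star: "\<And>x. x \<in> F \<Longrightarrow> \<Lambda> (lpa_class (free_star x)) = lpa_star (\<Lambda> (lpa_class x))"
    using \<Lambda> by (auto simp: star_endomorphism_def lpa_star_class[symmetric])
  have edge: "\<Lambda> (lpa_class (gen (Edge e))) = lpa_class (u * gen (Edge e))" if "e \<in> arcs E" for e
    using S[OF that] that by (simp add: lpa_S_class lpa_class_mult)
  have gen: "\<Lambda> (lpa_class (gen g)) = lpa_class (lambda_gen u g)" if "g \<in> lpa_gens E" for g
  proof (cases g)
    case (Vertex v)
    then show ?thesis using that P by (auto simp: lpa_gens_def lpa_P_class)
  next
    case (Edge e)
    then show ?thesis using that edge by (auto simp: lpa_gens_def)
  next
    case (Edge_star e)
    then have "e \<in> arcs E" using that by (auto simp: lpa_gens_def)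
    then show ?thesis
      using star[of "gen (Edge e)"] edge Edge_star by (simp add: lpa_star_class free_star_mult)
  qed
  show ?thesis
    using \<open>x \<in> F\<close>
  proof (induction rule: F_induct)
    case one
    then show ?case using ring_hom_one[OF hom] by (simp add: lpa_class_one)
  next
    case (gen_mult g y)
    then have "\<Lambda> (lpa_class (gen g * y)) = \<Lambda> (lpa_class (gen g)) \<otimes>\<^bsub>lpa E\<^esub> \<Lambda> (lpa_class y)"
      using ring_hom_mult[OF hom, of "lpa_class (gen g)" "lpa_class y"]
      by (simp add: lpa_class_mult F_gen)
    with gen_mult show ?case
      by (simp add: gen lpa_class_mult F_lambda_gen F_free_lambda free_subst_mult)
  next
    case (diff y z)
    \<comment> \<open>The value at the difference is named w and computed from additivity on (y - z)
      + z, which avoids subtraction in the quotient ring.\<close>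
    then obtain w where w: "w \<in> F" "\<Lambda> (lpa_class (y - z)) = lpa_class w"
      using ring_hom_closed[OF hom, of "lpa_class (y - z)"] by (auto simp: carrier_lpa F_diff)
    have "\<Lambda> (lpa_class (y - z + z)) = lpa_class (w + free_lambda u z)"
      using diff w ring_hom_add[OF hom, of "lpa_class (y - z)" "lpa_class z"]
      by (simp add: lpa_class_add F_diff F_free_lambda del: diff_add_cancel)
    then have "w + free_lambda u z \<approx> free_lambda u y"
      using diff w lpa_class_eq_iff[of "w + free_lambda u z" "free_lambda u y"]
      by (simp add: F_add F_free_lambda)
    then have "w \<approx> free_lambda u (y - z)"
      using w diff by (auto simp: lpa_cong_def free_subst_diff algebra_simps)
    then show ?case using w by (simp add: lpa_class_cong)
  qed
qed

end

text \<open>\<open>lambda\<close> satisfies the definite description, and any candidate agrees with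
  it on the carrier by uniqueness and elsewhere by extensionality. Hence \<open>lpa_Lambda\<close>
  can be computed on representatives.\<close>

lemma (in leavitt) lpa_Lambda_class:
  assumes J: "parallel_pairs E J" and unitary: "lpa_unitary E (lpa_u E J)" and x: "x \<in> F"
  shows "lpa_Lambda E J (lpa_class x) = lpa_class (free_lambda (free_u J) x)"
proof -
  have u: "lpa_u E J = lpa_class (free_u J)"
    by (rule lpa_u_class[OF J])
  interpret leavitt_unitary E "free_u J"
    using lpa_unitary_class[of "free_u J"] unitary J
    by unfold_locales (auto simp: u cong_vertex_free_u)
  have "lpa_Lambda E J = lambda"
    unfolding lpa_Lambda_def
  proof (rule the_equality, intro conjI ballI)
    show "lambda \<in> extensional (carrier (lpa E))"
      unfolding lambda_def by (rule restrict_extensional)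
    show "star_endomorphism E lambda" by (rule star_endomorphism_lambda)
    show "lambda (lpa_S E e) = lpa_u E J \<otimes>\<^bsub>lpa E\<^esub> lpa_S E e" if "e \<in> arcs E" for e
      using that by (simp add: lpa_S_class lambda_class u lpa_class_mult)
    show "lambda (lpa_P E v) = lpa_P E v" if "v \<in> verts E" for v
      using that by (simp add: lpa_P_class lambda_class)
  next
    fix \<Lambda>
    assume \<Lambda>: "\<Lambda> \<in> extensional (carrier (lpa E)) \<and> star_endomorphism E \<Lambda> \<and>
      (\<forall>e\<in>arcs E. \<Lambda> (lpa_S E e) = lpa_u E J \<otimes>\<^bsub>lpa E\<^esub> lpa_S E e) \<and>
      (\<forall>v\<in>verts E. \<Lambda> (lpa_P E v) = lpa_P E v)"
    show "\<Lambda> = lambda"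
    proof (rule extensionalityI[of _ "carrier (lpa E)"])
      show "lambda \<in> extensional (carrier (lpa E))"
        unfolding lambda_def by (rule restrict_extensional)
      fix X assume "X \<in> carrier (lpa E)"
      then obtain y where y: "y \<in> F" "X = lpa_class y" by (auto simp: carrier_lpa)
      with \<Lambda> u show "\<Lambda> X = lambda X"
        using star_endomorphism_eq_lambda[of \<Lambda> y] by (simp add: lambda_class)
    qed (use \<Lambda> in simp)
  qed
  with x show ?thesis by (simp add: lambda_class)
qed

section \<open>Products of sums\<close>

text \<open>Distributivity: a summand of the expanded product chooses an element in the fibre over
  each entry of \<open>es\<close>. The order of factors is kept, as the ring need not be
  commutative.\<close>

lemma prod_list_sum_fibres:
  fixes f :: "'a \<Rightarrow> 'r::semiring_1"
  assumes "finite A"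
  shows "prod_list (map (\<lambda>e. \<Sum>x\<in>{x \<in> A. c x = e}. f x) es) =
    (\<Sum>xs\<in>{xs. set xs \<subseteq> A \<and> map c xs = es}. prod_list (map f xs))"
proof (induction es)
  case Nil
  have "{xs. set xs \<subseteq> A \<and> map c xs = []} = {[]}" by auto
  then show ?case by simp
next
  case (Cons e es)
  let ?A = "{x \<in> A. c x = e}" and ?W = "\<lambda>es. {xs. set xs \<subseteq> A \<and> map c xs = es}"
  have bij: "bij_betw (\<lambda>(x, xs). x # xs) (?A \<times> ?W es) (?W (e # es))"
    by (rule bij_betw_byWitness[where f' = "\<lambda>xs. (hd xs, tl xs)"]) auto
  have "prod_list (map (\<lambda>e. \<Sum>x\<in>{x \<in> A. c x = e}. f x) (e # es)) =
      (\<Sum>x\<in>?A. f x) * (\<Sum>xs\<in>?W es. prod_list (map f xs))"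
    using Cons by simp
  also have "\<dots> = (\<Sum>(x, xs)\<in>?A \<times> ?W es. f x * prod_list (map f xs))"
    by (simp add: sum_product sum.cartesian_product)
  also have "\<dots> = (\<Sum>xs\<in>?W (e # es). prod_list (map f xs))"
    by (subst sum.reindex_bij_betw[OF bij, symmetric]) (auto intro!: sum.cong)
  finally show ?case .
qed

text \<open>Rebrackets (a1 b1)(a2 b2)...(ak bk) as a1 (b1 a2)(b2 a3)... bk; the inner factors belong
  to consecutive entries and form an empty product for a singleton.\<close>

lemma prod_list_regroup:
  fixes a b :: "'a \<Rightarrow> 'r::monoid_mult"
  assumes "xs \<noteq> []"
  shows "prod_list (map (\<lambda>x. a x * b x) xs) =
    a (hd xs) * prod_list (map (\<lambda>(x, y). b x * a y) (zip xs (tl xs))) * b (last xs)"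
  using assms
proof (induction xs rule: list_nonempty_induct)
  case (cons x xs)
  then obtain y ys where "xs = y # ys" by (cases xs) auto
  with cons show ?case by (simp add: mult.assoc)
qed simp

section \<open>Paths in the coding graph\<close>

text \<open>When arcs are pairs of vertices, a nonempty vertex list determines its walk. This
  concerns incidence alone; that the pairs are arcs is a separate check.\<close>

lemma awalk_verts_zip:
  assumes "tail G = fst" "head G = snd" "xs \<noteq> []"
  shows "pre_digraph.awalk_verts G (hd xs) (zip xs (tl xs)) = xs"
    and "pre_digraph.cas G (hd xs) (zip xs (tl xs)) (last xs)"
  using assms(3)
proof (induction xs rule: list_nonempty_induct)
  case (cons x xs)
  then obtain y ys where "xs = y # ys" by (cases xs) auto
  with cons show "pre_digraph.awalk_verts G (hd (x # xs)) (zip (x # xs) (tl (x # xs))) = x # xs"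
    and "pre_digraph.cas G (hd (x # xs)) (zip (x # xs) (tl (x # xs))) (last (x # xs))"
    using assms(1,2) by (simp_all add: pre_digraph.awalk_verts.simps pre_digraph.cas.simps)
qed (simp_all add: pre_digraph.awalk_verts.simps pre_digraph.cas.simps)

text \<open>The converse direction: a walk is recovered from its vertex list.\<close>

lemma zip_awalk_verts:
  assumes "tail G = fst" "head G = snd" "pre_digraph.cas G x p y"
  shows "hd (pre_digraph.awalk_verts G x p) = x"
    and "zip (pre_digraph.awalk_verts G x p) (tl (pre_digraph.awalk_verts G x p)) = p"
proof -
  have "hd (pre_digraph.awalk_verts G x p) = x \<and>
    zip (pre_digraph.awalk_verts G x p) (tl (pre_digraph.awalk_verts G x p)) = p"
    using assms(3)
  proof (induction p arbitrary: x)
    case (Cons a p)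
    obtain z zs where "pre_digraph.awalk_verts G (snd a) p = z # zs"
      using pre_digraph.awalk_verts_non_Nil by (meson neq_Nil_conv)
    with Cons.IH[of "snd a"] Cons.prems assms(1,2) show ?case
      by (auto simp: pre_digraph.awalk_verts.simps pre_digraph.cas.simps)
  qed (simp add: pre_digraph.awalk_verts.simps)
  then show "hd (pre_digraph.awalk_verts G x p) = x"
    and "zip (pre_digraph.awalk_verts G x p) (tl (pre_digraph.awalk_verts G x p)) = p" by auto
qed

lemma set_awalk_verts_subset:
  assumes "tail G = fst" "head G = snd" "x \<in> A" "set p \<subseteq> A \<times> A"
  shows "set (pre_digraph.awalk_verts G x p) \<subseteq> A"
  using assms(3,4)
proof (induction p arbitrary: x)
  case (Cons a p)
  then show ?case
    using Cons.IH[of "snd a"] by (cases a) (simp add: assms(1,2) pre_digraph.awalk_verts.simps)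
qed (simp add: pre_digraph.awalk_verts.simps)

section \<open>The coding formula\<close>

text \<open>Representative of \<open>code_label\<close> in the free ring, so that labels and their
  vanishing can be treated by congruences.\<close>

definition code_weight ::
  "('v, 'e) pre_digraph \<Rightarrow> ('v, 'e) path_pair \<times> ('v, 'e) path_pair \<Rightarrow> ('v, 'e) free_lpa" where
  "code_weight E = (\<lambda>(x, y). free_star (free_path (code_nu E x)) * free_path (code_mu y))"

text \<open>Nonempty second components make \<open>code_edge\<close> and \<open>code_nu\<close> an
  actual first edge and remaining path.\<close>

locale leavitt_coding = leavitt E for E :: "('v, 'e) pre_digraph" +
  fixes J :: "('v, 'e) path_pair set"
  assumes J: "parallel_pairs E J" and second_nonempty: "x \<in> J \<Longrightarrow> snd (snd x) \<noteq> []"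
begin

lemma finite_J: "finite J"
  using J by (simp add: parallel_pairs_def)

lemma code_mu_path: "x \<in> J \<Longrightarrow> code_mu x \<in> graph_paths E"
  using parallel_pairsD[OF J] by (simp add: code_mu_def)

lemma snd_code:
  assumes "x \<in> J"
  shows "snd (snd x) = code_edge x # snd (code_nu E x)" "code_edge x \<in> arcs E"
    "code_nu E x \<in> graph_paths E" "path_range E (code_nu E x) = path_range E (code_mu x)"
    "fst (code_nu E x) = head E (code_edge x)"
proof -
  obtain e p where ep: "snd (snd x) = e # p"
    using second_nonempty[OF assms] by (cases "snd (snd x)") auto
  note path = graph_pathsD[OF parallel_pairsD(2)[OF J assms]]
  show "snd (snd x) = code_edge x # snd (code_nu E x)" "code_edge x \<in> arcs E"
    "fst (code_nu E x) = head E (code_edge x)"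
    using path ep by (auto simp: code_edge_def code_nu_def)
  have "awalk (head E e) p (path_range E (snd x))"
    using path ep by (auto simp: awalk_def)
  then show "code_nu E x \<in> graph_paths E" "path_range E (code_nu E x) = path_range E (code_mu x)"
    using ep parallel_pairsD(4)[OF J assms] awlast_if_cas
    by (auto simp: code_nu_def code_edge_def graph_paths_def path_range_def code_mu_def awalk_def)
qed

text \<open>The star of the path ends in the adjoint of its first edge, which against
  \<open>e\<close> gives zero or the range vertex of that edge.\<close>

lemma cong_star_path_edge:
  assumes x: "x \<in> J" and e: "e \<in> arcs E"
  shows "free_star (free_path (snd x)) * gen (Edge e) \<approx>
    (if code_edge x = e then free_star (free_path (code_nu E x)) else 0)"
proof -
  note x' = snd_code[OF x]
  let ?r = "prod_list (map (\<lambda>e. gen (Edge e)) (snd (code_nu E x)))"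
  have r: "?r \<in> F"
    using graph_pathsD(2)[OF x'(3)] by (rule F_edges)
  \<comment> \<open>If the remaining path is a vertex, then \<open>?r\<close> is 1 but
    \<open>free_path\<close> is a vertex idempotent. The idempotent left by the star relation
    supplies it, and is absorbed if edges remain.\<close>
  have head: "gen (Vertex (head E (code_edge x))) * ?r \<approx> free_path (code_nu E x)"
  proof (cases "snd (code_nu E x) = []")
    case True
    then show ?thesis
      using F_free_path[OF x'(3)] x'(5) by (simp add: free_path_def)
  next
    case False
    then show ?thesis
      using cong_vertex_path[OF graph_pathsD(1) x'(3), OF x'(3)] x'(5)
      by (simp add: free_path_def)
  qed
  have "free_path (snd x) = gen (Edge (code_edge x)) * ?r"
    by (simp add: free_path_def x'(1))
  then have "free_star (free_path (snd x)) * gen (Edge e) =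
      free_star ?r * (gen (Edge_star (code_edge x)) * gen (Edge e))"
    by (simp add: free_star_mult mult.assoc)
  also have "\<dots> \<approx> free_star ?r * (if code_edge x = e then gen (Vertex (head E (code_edge x))) else 0)"
    using e x'(2) r by (intro cong_mult cong_star_edge) auto
  also have "\<dots> = (if code_edge x = e
      then free_star (gen (Vertex (head E (code_edge x))) * ?r) else 0)"
    by (simp add: free_star_mult)
  also have "\<dots> \<approx> (if code_edge x = e then free_star (free_path (code_nu E x)) else 0)"
    using cong_star[OF head] by auto
  finally show ?thesis .
qed

lemma cong_u_edge:
  assumes e: "e \<in> arcs E"
  shows "free_u J * gen (Edge e) \<approx>
    (\<Sum>x\<in>{x \<in> J. code_edge x = e}. free_path (code_mu x) * free_star (free_path (code_nu E x)))"
proof -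
  have "free_u J * gen (Edge e) =
      (\<Sum>x\<in>J. free_path (code_mu x) * (free_star (free_path (snd x)) * gen (Edge e)))"
    by (simp add: free_u_def sum_distrib_right mult.assoc code_mu_def)
  also have "\<dots> \<approx> (\<Sum>x\<in>J. free_path (code_mu x) *
      (if code_edge x = e then free_star (free_path (code_nu E x)) else 0))"
    using e by (intro cong_sum cong_mult cong_star_path_edge cong_refl F_free_path code_mu_path)
  also have "\<dots> = (\<Sum>x\<in>J. if code_edge x = e
      then free_path (code_mu x) * free_star (free_path (code_nu E x)) else 0)"
    by (intro sum.cong) auto
  also have "\<dots> =
      (\<Sum>x\<in>{x \<in> J. code_edge x = e}. free_path (code_mu x) * free_star (free_path (code_nu E x)))"
    by (intro sum.inter_filter[symmetric] finite_J)
  finally show ?thesis .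
qed

text \<open>For the edges of a nonempty path these are the vertex lists of the coding paths that
  spell it, by \<open>list_path_image\<close>; the last condition says that all labels are
  nonzero.\<close>

definition code_lists :: "'e list \<Rightarrow> ('v, 'e) path_pair list set" where
  "code_lists p = {xs. set xs \<subseteq> J \<and> map code_edge xs = p \<and>
     (\<forall>a\<in>set (zip xs (tl xs)). \<not> code_weight E a \<approx> 0)}"

text \<open>Representative of the summand of one coding path. The singleton case follows the
  convention that a path without arcs is labelled by a vertex idempotent.\<close>

definition code_term :: "('v, 'e) path_pair list \<Rightarrow> ('v, 'e) free_lpa" where
  "code_term xs = free_path (code_mu (hd xs)) *
     (if tl xs = [] then gen (Vertex (path_range E (code_mu (hd xs))))
      else prod_list (map (code_weight E) (zip xs (tl xs)))) *
     free_star (free_path (code_nu E (last xs)))"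

lemma F_code_weight:
  assumes "a \<in> J \<times> J" shows "code_weight E a \<in> F"
proof -
  obtain x y where Pair: "a = (x, y)" by (rule prod.exhaust)
  with assms have "x \<in> J" "y \<in> J" by simp_all
  then show ?thesis
    unfolding Pair code_weight_def prod.case
    by (intro F_mult F_free_star F_free_path snd_code(3) code_mu_path)
qed

lemma path_range_verts: "\<mu> \<in> graph_paths E \<Longrightarrow> path_range E \<mu> \<in> verts E"
  using graph_pathsD[of \<mu>] by (auto simp: path_range_def intro: awlast_in_verts)

lemma set_zip_tl:
  assumes "a \<in> set (zip xs (tl xs))" "set xs \<subseteq> J"
  shows "a \<in> J \<times> J"
proof -
  obtain x y where a: "a = (x, y)" by (rule prod.exhaust)
  then have "x \<in> set xs" "y \<in> set (tl xs)" "xs \<noteq> []"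
    using assms(1) by (auto dest: set_zip_leftD set_zip_rightD)
  then show ?thesis
    using a assms(2) list.set_sel(2)[of xs y] by blast
qed

lemma F_code_weights:
  "set xs \<subseteq> J \<Longrightarrow> prod_list (map (code_weight E) (zip xs (tl xs))) \<in> F"
  by (rule F_prod_list) (unfold set_map, blast intro: set_zip_tl F_code_weight)

lemma F_ends:
  assumes "set xs \<subseteq> J" "xs \<noteq> []"
  shows "free_path (code_mu (hd xs)) \<in> F" "free_star (free_path (code_nu E (last xs))) \<in> F"
  using assms hd_in_set[of xs] last_in_set[of xs] snd_code(3) code_mu_path by blast+

lemma F_code_term:
  assumes "set xs \<subseteq> J" "xs \<noteq> []"
  shows "code_term xs \<in> F"
proof -
  have "hd xs \<in> J" using assms hd_in_set by blast
  then have "gen (Vertex (path_range E (code_mu (hd xs)))) \<in> F"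
    by (intro F_vertex path_range_verts code_mu_path)
  then show ?thesis
    using F_ends[OF assms] F_code_weights[OF assms(1)]
    by (auto simp: code_term_def intro!: F_mult)
qed

text \<open>For two or more entries this is an exact rebracketing; for a single entry the extra
  vertex idempotent is absorbed by the path before it.\<close>

lemma cong_code_term:
  assumes xs: "set xs \<subseteq> J" "xs \<noteq> []"
  shows "prod_list (map (\<lambda>x. free_path (code_mu x) * free_star (free_path (code_nu E x))) xs) \<approx>
    code_term xs"
proof (cases "tl xs = []")
  case True
  with xs obtain x where x: "xs = [x]" "x \<in> J" by (cases xs) auto
  have "free_path (code_mu x) * gen (Vertex (path_range E (code_mu x))) *
      free_star (free_path (code_nu E x)) \<approx> free_path (code_mu x) * free_star (free_path (code_nu E x))"
    using x F_ends[of xs] by (intro cong_mult cong_path_vertex code_mu_path) auto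
  then show ?thesis
    using x cong_sym by (simp add: code_term_def)
next
  case False
  then show ?thesis
    using F_code_term[OF xs] xs
    by (simp add: prod_list_regroup code_term_def code_weight_def)
qed

text \<open>The vanishing label is a factor of the middle product.\<close>

lemma cong_code_term_0:
  assumes xs: "set xs \<subseteq> J" "xs \<noteq> []"
    and a: "a \<in> set (zip xs (tl xs))" "code_weight E a \<approx> 0"
  shows "code_term xs \<approx> 0"
proof -
  obtain as bs where "zip xs (tl xs) = as @ a # bs"
    using a(1) by (meson split_list)
  moreover have "prod_list (map (code_weight E) as) \<in> F" "prod_list (map (code_weight E) bs) \<in> F"
    using calculation set_zip_tl[OF _ xs(1)] F_code_weight
    by (intro F_prod_list; unfold set_map; force)+
  moreover have "prod_list (map (code_weight E) (as @ a # bs)) =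
      prod_list (map (code_weight E) as) * (code_weight E a * prod_list (map (code_weight E) bs))"
    by simp
  ultimately have "prod_list (map (code_weight E) (zip xs (tl xs))) \<approx>
      prod_list (map (code_weight E) as) * (0 * prod_list (map (code_weight E) bs))"
    using a(2) by (metis cong_mult cong_refl)
  then have "free_path (code_mu (hd xs)) * prod_list (map (code_weight E) (zip xs (tl xs))) *
      free_star (free_path (code_nu E (last xs))) \<approx>
      free_path (code_mu (hd xs)) * (prod_list (map (code_weight E) as) *
        (0 * prod_list (map (code_weight E) bs))) * free_star (free_path (code_nu E (last xs)))"
    using F_ends[OF xs] by (intro cong_mult cong_refl)
  \<comment> \<open>A consecutive pair exists, so the product branch of \<open>code_term\<close>
    applies.\<close>
  moreover have "tl xs \<noteq> []" using a(1) by auto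
  ultimately show ?thesis by (simp add: code_term_def)
qed

lemma finite_code_lists: "finite {xs. set xs \<subseteq> J \<and> map code_edge xs = p}"
  by (rule finite_subset[OF _ finite_lists_length_eq[OF finite_J, of "length p"]]) auto

text \<open>Expanding the product of the sums from \<open>cong_u_edge\<close> gives a term for every
  list in \<open>J\<close> spelling \<open>p\<close>; a list outside \<open>code_lists\<close> has a
  vanishing label and contributes zero.\<close>

lemma cong_free_lambda_edges:
  assumes p: "set p \<subseteq> arcs E" "p \<noteq> []"
  shows "free_lambda (free_u J) (prod_list (map (\<lambda>e. gen (Edge e)) p)) \<approx>
    (\<Sum>xs\<in>code_lists p. code_term xs)"
proof -
  let ?f = "\<lambda>x. free_path (code_mu x) * free_star (free_path (code_nu E x))"
  let ?W = "{xs. set xs \<subseteq> J \<and> map code_edge xs = p}"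
  have "free_lambda (free_u J) (prod_list (map (\<lambda>e. gen (Edge e)) p)) =
      prod_list (map (\<lambda>e. free_u J * gen (Edge e)) p)"
    by (simp add: free_subst_prod_list comp_def)
  also have "\<dots> \<approx> prod_list (map (\<lambda>e. \<Sum>x\<in>{x \<in> J. code_edge x = e}. ?f x) p)"
    using p by (intro cong_prod_list cong_u_edge) auto
  also have "\<dots> = (\<Sum>xs\<in>?W. prod_list (map ?f xs))"
    by (rule prod_list_sum_fibres[OF finite_J])
  also have "\<dots> \<approx> (\<Sum>xs\<in>?W. if xs \<in> code_lists p then code_term xs else 0)"
  proof (rule cong_sum)
    fix xs assume "xs \<in> ?W"
    then have xs: "set xs \<subseteq> J" "xs \<noteq> []" "map code_edge xs = p" using p by auto
    show "prod_list (map ?f xs) \<approx> (if xs \<in> code_lists p then code_term xs else 0)"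
    proof (cases "xs \<in> code_lists p")
      case False
      with xs have "code_term xs \<approx> 0"
        using cong_code_term_0 by (auto simp: code_lists_def)
      with False show ?thesis
        using cong_trans[OF cong_code_term[OF xs(1,2)]] by simp
    qed (simp add: cong_code_term xs)
  qed
  also have "\<dots> = (\<Sum>xs\<in>?W \<inter> code_lists p. code_term xs)"
    by (rule sum.inter_restrict[OF finite_code_lists, symmetric])
  also have "?W \<inter> code_lists p = code_lists p"
    by (auto simp: code_lists_def)
  finally show ?thesis .
qed

section \<open>Labels and paths of the coding graph\<close>

lemma code_label_class:
  assumes "a \<in> J \<times> J"
  shows "code_label E a = lpa_class (code_weight E a)"
proof -
  obtain x y where Pair: "a = (x, y)" by (rule prod.exhaust)
  with assms have "x \<in> J" "y \<in> J" by simp_all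
  then show ?thesis
    by (simp add: Pair code_label_def code_weight_def path_S_class lpa_star_class lpa_class_mult
        snd_code(3) code_mu_path F_free_path F_free_star)
qed

lemma code_label_zero_iff:
  assumes "a \<in> J \<times> J"
  shows "code_label E a = \<zero>\<^bsub>lpa E\<^esub> \<longleftrightarrow> code_weight E a \<approx> 0"
  by (simp add: code_label_class assms lpa_class_zero lpa_class_eq_iff F_code_weight)

lemma coding_graph_simps:
  "verts (coding_graph E J) = J" "tail (coding_graph E J) = fst" "head (coding_graph E J) = snd"
  "arcs (coding_graph E J) = {a \<in> J \<times> J. \<not> code_weight E a \<approx> 0}"
  by (simp_all add: coding_graph_def code_label_zero_iff cong: conj_cong)

definition list_path :: "('v, 'e) path_pair list \<Rightarrow> ('v, 'e) code_path" where
  "list_path xs = (hd xs, zip xs (tl xs))"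

lemma awalk_verts_list_path:
  assumes "xs \<noteq> []"
  shows "pre_digraph.awalk_verts (coding_graph E J) (fst (list_path xs)) (snd (list_path xs)) = xs"
  using awalk_verts_zip(1)[OF coding_graph_simps(2,3) assms] by (simp add: list_path_def)

text \<open>Reading off the vertices of the walk is a left inverse.\<close>

lemma inj_list_path: "inj_on list_path {xs. xs \<noteq> []}"
  by (rule inj_on_inverseI[where g = "\<lambda>\<omega>.
        pre_digraph.awalk_verts (coding_graph E J) (fst \<omega>) (snd \<omega>)"])
    (simp add: awalk_verts_list_path)

text \<open>Arcs are exactly the pairs with nonzero label, so a list in \<open>code_lists\<close>
  and a coding path carry the same data.\<close>

lemma list_path_image:
  assumes \<alpha>: "\<alpha> \<in> graph_paths E" "snd \<alpha> \<noteq> []"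
  shows "list_path ` code_lists (snd \<alpha>) =
    {\<omega> \<in> graph_paths (coding_graph E J). code_word E J \<omega> = \<alpha>}"
proof (intro equalityI subsetI)
  fix \<omega> assume "\<omega> \<in> list_path ` code_lists (snd \<alpha>)"
  then obtain xs where xs: "xs \<in> code_lists (snd \<alpha>)" and \<omega>: "\<omega> = list_path xs" by auto
  have ne: "xs \<noteq> []" using xs \<alpha> by (auto simp: code_lists_def)
  have "pre_digraph.awalk (coding_graph E J) (hd xs) (zip xs (tl xs)) (last xs)"
    unfolding pre_digraph.awalk_def coding_graph_simps(1,4)
    using awalk_verts_zip(2)[OF coding_graph_simps(2,3) ne] xs ne set_zip_tl[of _ xs]
    by (auto simp: code_lists_def)
  then have "\<omega> \<in> graph_paths (coding_graph E J)"
    unfolding graph_paths_def \<omega> list_path_def by blast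
  \<comment> \<open>\<open>code_word\<close> records the tail of the first edge as source, which is
    the source of \<alpha> because \<alpha> is a nonempty path.\<close>
  moreover have "tail E (code_edge (hd xs)) = fst \<alpha>"
    using graph_pathsD(3)[OF \<alpha>(1)] \<alpha>(2) xs hd_map[OF ne, of code_edge]
    by (simp add: cas_simp code_lists_def)
  then have "code_word E J \<omega> = \<alpha>"
    using xs ne awalk_verts_list_path[OF ne]
    by (auto simp: code_word_def \<omega> code_lists_def path_source_def list_path_def prod_eq_iff)
  ultimately show "\<omega> \<in> {\<omega> \<in> graph_paths (coding_graph E J). code_word E J \<omega> = \<alpha>}" by simp
next
  fix \<omega> assume \<omega>: "\<omega> \<in> {\<omega> \<in> graph_paths (coding_graph E J). code_word E J \<omega> = \<alpha>}"
  obtain x p where [simp]: "\<omega> = (x, p)" by (cases \<omega>)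
  let ?xs = "pre_digraph.awalk_verts (coding_graph E J) x p"
  from \<omega> obtain y where walk: "x \<in> J" "set p \<subseteq> {a \<in> J \<times> J. \<not> code_weight E a \<approx> 0}"
      "pre_digraph.cas (coding_graph E J) x p y"
    by (auto simp: graph_paths_def pre_digraph.awalk_def coding_graph_simps(1,4))
  note zip = zip_awalk_verts[OF coding_graph_simps(2,3) walk(3)]
  have "set ?xs \<subseteq> J"
    by (rule set_awalk_verts_subset[OF coding_graph_simps(2,3) walk(1)]) (use walk(2) in auto)
  then have "?xs \<in> code_lists (snd \<alpha>)"
    using \<omega> walk(2) zip(2) by (auto simp: code_lists_def code_word_def)
  moreover have "\<omega> = list_path ?xs"
    using zip by (simp add: list_path_def)
  ultimately show "\<omega> \<in> list_path ` code_lists (snd \<alpha>)" by blast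
qed

lemma path_label_class:
  assumes "set xs \<subseteq> J" "xs \<noteq> []"
  shows "path_label E (list_path xs) =
    lpa_class (if tl xs = [] then gen (Vertex (path_range E (code_mu (hd xs))))
      else prod_list (map (code_weight E) (zip xs (tl xs))))"
proof -
  have "map (code_label E) (zip xs (tl xs)) = map lpa_class (map (code_weight E) (zip xs (tl xs)))"
    using set_zip_tl[OF _ assms(1)] code_label_class by simp
  moreover have "set (map (code_weight E) (zip xs (tl xs))) \<subseteq> F"
    unfolding set_map using set_zip_tl[OF _ assms(1)] F_code_weight by blast
  ultimately have "foldr (mult (lpa E)) (map (code_label E) (zip xs (tl xs))) \<one>\<^bsub>lpa E\<^esub> =
      lpa_class (prod_list (map (code_weight E) (zip xs (tl xs))))"
    using lpa_class_foldr by metis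
  \<comment> \<open>\<open>path_label\<close> splits on the list of arcs, the claim on the tail of
    the vertex list.\<close>
  moreover have "zip xs (tl xs) = [] \<longleftrightarrow> tl xs = []"
    using assms(2) by (cases xs; cases "tl xs") simp_all
  ultimately show ?thesis
    by (simp add: path_label_def list_path_def lpa_P_class)
qed

lemma code_term_class:
  assumes xs: "set xs \<subseteq> J" "xs \<noteq> []"
  shows "label_s E (list_path xs) \<otimes>\<^bsub>lpa E\<^esub> path_label E (list_path xs) \<otimes>\<^bsub>lpa E\<^esub>
    lpa_star (label_r E J (list_path xs)) = lpa_class (code_term xs)"
proof -
  have ends: "hd xs \<in> J" "last xs \<in> J"
    using subsetD[OF xs(1) hd_in_set[OF xs(2)]] subsetD[OF xs(1) last_in_set[OF xs(2)]] .
  have "label_s E (list_path xs) = lpa_class (free_path (code_mu (hd xs)))"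
    using ends by (simp add: label_s_def path_source_def list_path_def path_S_class code_mu_path)
  moreover have "path_range (coding_graph E J) (list_path xs) = last xs"
    unfolding path_range_def awalk_verts_list_path[OF xs(2)] ..
  then have "lpa_star (label_r E J (list_path xs)) =
      lpa_class (free_star (free_path (code_nu E (last xs))))"
    using ends(2) by (simp add: label_r_def path_S_class snd_code(3) lpa_star_class)
  moreover have "(if tl xs = [] then gen (Vertex (path_range E (code_mu (hd xs))))
      else prod_list (map (code_weight E) (zip xs (tl xs)))) \<in> F"
    using ends(1) F_code_weights[OF xs(1)] by (simp add: path_range_verts code_mu_path)
  ultimately show ?thesis
    using F_ends[OF xs]
    by (simp only: path_label_class[OF xs] lpa_class_mult F_mult code_term_def)
qed

text \<open>Passes the expansion over lists to the quotient and reindexes it along the injection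
  \<open>list_path\<close>.\<close>

lemma lpa_Lambda_path:
  assumes unitary: "lpa_unitary E (lpa_u E J)"
    and \<alpha>: "\<alpha> \<in> graph_paths E" "snd \<alpha> \<noteq> []"
  shows "lpa_Lambda E J (path_S E \<alpha>) =
    (\<Oplus>\<^bsub>lpa E\<^esub>\<omega> \<in> {\<omega> \<in> graph_paths (coding_graph E J). code_word E J \<omega> = \<alpha>}.
       label_s E \<omega> \<otimes>\<^bsub>lpa E\<^esub> path_label E \<omega> \<otimes>\<^bsub>lpa E\<^esub> lpa_star (label_r E J \<omega>))"
    (is "_ = finsum _ ?t _")
proof -
  interpret L: ring "lpa E" by (rule ring_lpa)
  let ?W = "code_lists (snd \<alpha>)"
  have W: "set xs \<subseteq> J" "xs \<noteq> []" if "xs \<in> ?W" for xs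
    using that \<alpha>(2) by (auto simp: code_lists_def)
  have inj: "inj_on list_path ?W"
    by (rule inj_on_subset[OF inj_list_path]) (use W in auto)
  have t: "?t (list_path xs) = lpa_class (code_term xs)" if "xs \<in> ?W" for xs
    using code_term_class W[OF that] by blast
  have "lpa_Lambda E J (path_S E \<alpha>) = lpa_class (free_lambda (free_u J) (free_path \<alpha>))"
    by (simp add: path_S_class \<alpha> lpa_Lambda_class J unitary F_free_path)
  also have "\<dots> = lpa_class (\<Sum>xs\<in>?W. code_term xs)"
    using cong_free_lambda_edges[of "snd \<alpha>"] \<alpha> graph_pathsD(2)[OF \<alpha>(1)]
    by (simp add: free_path_def lpa_class_cong)
  also have "\<dots> = (\<Oplus>\<^bsub>lpa E\<^esub>xs\<in>?W. lpa_class (code_term xs))"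
    using F_code_term W by (intro lpa_class_finsum[symmetric]) blast
  also have "\<dots> = (\<Oplus>\<^bsub>lpa E\<^esub>xs\<in>?W. ?t (list_path xs))"
    using F_code_term W t by (intro L.finsum_cong') auto
  also have "\<dots> = finsum (lpa E) ?t (list_path ` ?W)"
    using F_code_term W t inj by (intro L.finsum_reindex[symmetric]) auto
  finally show ?thesis
    unfolding list_path_image[OF \<alpha>] .
qed

end

text \<open>Code words have at least one edge, so for a vertex the sum would be empty while the
  endomorphism fixes P_v; hence the length condition on \<alpha>. The length condition on second
  components expresses the form (mu, e nu).\<close>

theorem lemma3p3:
  fixes E :: "('v, 'e) pre_digraph"
    and J :: "('v, 'e) path_pair set"
    and \<alpha> :: "'v \<times> 'e list"
  assumes "fin_digraph E" and "no_sinks E" and "no_sources E"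
    and "\<And>\<mu>. closed_path E \<mu> \<Longrightarrow> has_exit E \<mu>"
    and "parallel_pairs E J" and "lpa_unitary E (lpa_u E J)"
    and "\<And>\<mu> \<nu>. (\<mu>, \<nu>) \<in> J \<Longrightarrow> path_length \<nu> \<ge> 1"
    and "\<alpha> \<in> graph_paths E" and "path_length \<alpha> \<ge> 1"
  shows "lpa_Lambda E J (path_S E \<alpha>) =
    (\<Oplus>\<^bsub>lpa E\<^esub>\<omega> \<in> {\<omega> \<in> graph_paths (coding_graph E J). code_word E J \<omega> = \<alpha>}.
       label_s E \<omega> \<otimes>\<^bsub>lpa E\<^esub> path_label E \<omega> \<otimes>\<^bsub>lpa E\<^esub> lpa_star (label_r E J \<omega>))"
proof -
  interpret fin_digraph E by (rule assms(1))
  interpret leavitt_coding E J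
  proof unfold_locales
    show "snd (snd x) \<noteq> []" if "x \<in> J" for x
      using assms(7)[of "fst x" "snd x"] that by (auto simp: path_length_def)
  qed (rule assms(5))
  show ?thesis
    using assms(9) by (intro lpa_Lambda_path assms(6,8)) (auto simp: path_length_def)
qed

end
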